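(* Let $p\in(0,\infty]$, $q\in(0,1]$ and let $b$ be a slowly varying function. Then, up to equivalence of the defining functionals: (i) If $p\in[1,\infty)$, then $(L^{p,q,b})'=L^{(p',\infty,b^{-1})}$. (ii) If $p=\infty$ and $\lVert t^{-1/q}b(t)\chi_{(0,1)}(t)\rVert_q<\infty$, then $(L^{\infty,q,b})'=L^{(1,\infty,a)}$, where $$a(t)=\left(\int_0^t s^{-1}b^q(s)\,ds\right)^{-1/q},\qquad t\in(0,\infty).$$
   Context: $(R,\mu)$ is a $\sigma$-finite non-atomic measure space with $\mu(R)=\infty$; $M=M(R,\mu)$ is the set of extended complex-valued $\mu$-measurable functions on $R$ (identified when equal $\mu$-a.e.). For $f\in M$, $f^*(t)=\inf\{s\ge 0:\mu(\{|f|>s\})\le t\}$ and $f^{**}(t)=\frac1t\int_0^t f^*(s)\,ds$. Conventions: $1/\infty=0$; $p'=p/(p-1)$ for $p\in(1,\infty)$, $1'=\infty$, $\infty'=1$; $b^{-1}=1/b$. A measurable $b:(0,\infty)\to(0,\infty)$ is slowly varying if for every $\varepsilon>0$ there are a non-decreasing function $b_\varepsilon$ and a non-increasing function $b_{-\varepsilon}$ with $t^\varepsilon b(t)\approx b_\varepsilon(t)$ and $t^{-\varepsilon}b(t)\approx b_{-\varepsilon}(t)$ on $(0,\infty)$, where $\approx$ denotes two-sided estimate up to positive finite multiplicative constants. For $f\in M$, $\lVert f\rVert_{p,q,b}=\lVert t^{1/p-1/q}b(t)f^*(t)\rVert_q$ and $\lVert f\rVert_{(p,q,b)}=\lVert t^{1/p-1/q}b(t)f^{**}(t)\rVert_q$,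 where $\lVert\cdot\rVert_q$ is the Lebesgue $L^q$ (quasi)norm over $(0,\infty)$ in the variable $t$; $L^{p,q,b}$ and $L^{(p,q,b)}$ are the sets of $f\in M$ for which the respective functional is finite. The associate space of a space $X=\{f\in M:\lVert f\rVert_X<\infty\}$ is $X'=\{f\in M:\lVert f\rVert_{X'}<\infty\}$, where $\lVert f\rVert_{X'}=\sup\{\int_R|fg|\,d\mu: g\in M,\ \lVert g\rVert_X\le1\}$. Equality of spaces up to equivalence of the defining functionals means that the sets coincide and the functionals are bounded by constant multiples of each other. *)

theory Defs
  imports "HOL-Analysis.Analysis" "HOL-Probability.Essential_Supremum"
begin

text \<open>A measure is passed as one object \<open>\<mu>\<close>; the underlying set \<open>R\<close> is \<open>space \<mu>\<close>.\<close>

definition nonatomic :: "'a measure \<Rightarrow> bool" where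
  "nonatomic \<mu> \<longleftrightarrow> (\<forall>A\<in>sets \<mu>. 0 < emeasure \<mu> A \<longrightarrow>
     (\<exists>B\<in>sets \<mu>. B \<subseteq> A \<and> 0 < emeasure \<mu> B \<and> emeasure \<mu> B < emeasure \<mu> A))"

text \<open>Extended complex numbers: the complex plane with one point at infinity.\<close>

datatype ecomplex = Fin complex | Infty

fun emod :: "ecomplex \<Rightarrow> ennreal" where
  "emod (Fin z) = ennreal (cmod z)"
| "emod Infty = \<infinity>"

text \<open>The Borel sets of the one-point compactification of the plane are the sets whose finite
  part is Borel.\<close>

definition ecomplex_borel :: "ecomplex measure" where
  "ecomplex_borel = sigma UNIV {A. Fin -` A \<in> sets borel}"

text \<open>Functions are not identified when they agree almost everywhere. Every functional below is
  invariant under almost everywhere equality, so an equality of the resulting sets of functions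
  is the same as an equality of the sets of equivalence classes.\<close>

abbreviation mfun :: "'a measure \<Rightarrow> ('a \<Rightarrow> ecomplex) set" where
  "mfun \<mu> \<equiv> measurable \<mu> ecomplex_borel"

text \<open>Only real \<open>s\<close> are admitted; the infimum of the empty set is \<open>\<infinity>\<close>.\<close>

definition rearr :: "'a measure \<Rightarrow> ('a \<Rightarrow> ecomplex) \<Rightarrow> real \<Rightarrow> ennreal" where
  "rearr \<mu> f t =
     (INF s\<in>{s::real. 0 \<le> s \<and> emeasure \<mu> {x\<in>space \<mu>. emod (f x) > ennreal s} \<le> ennreal t}. ennreal s)"

definition max_rearr :: "'a measure \<Rightarrow> ('a \<Rightarrow> ecomplex) \<Rightarrow> real \<Rightarrow> ennreal" where
  "max_rearr \<mu> f t = ennreal (1 / t) * (\<integral>\<^sup>+s\<in>{0<..<t}. rearr \<mu> f s \<partial>lebesgue)"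

text \<open>Powers of extended nonnegative reals, used only with a positive exponent.\<close>

definition epowr :: "ennreal \<Rightarrow> real \<Rightarrow> ennreal" where
  "epowr x r = (if x = \<infinity> then \<infinity> else ennreal (enn2real x powr r))"

definition Lq_norm :: "ennreal \<Rightarrow> (real \<Rightarrow> ennreal) \<Rightarrow> ennreal" where
  "Lq_norm q g =
     (if q = \<infinity> then esssup (lebesgue_on {0<..}) g
      else epowr (\<integral>\<^sup>+t. epowr (g t) (enn2real q) \<partial>lebesgue_on {0<..}) (1 / enn2real q))"

text \<open>The inverse of \<open>\<infinity>\<close> in \<^typ>\<open>ennreal\<close> is 0, so this follows the convention
  \<open>1/\<infinity> = 0\<close>. Used only for nonzero arguments.\<close>

definition recip :: "ennreal \<Rightarrow> real" where
  "recip p = enn2real (inverse p)"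

definition dual_exponent :: "ennreal \<Rightarrow> ennreal" where
  "dual_exponent p = (if p = 1 then \<infinity> else if p = \<infinity> then 1 else p / (p - 1))"

definition approx_equiv :: "(real \<Rightarrow> real) \<Rightarrow> (real \<Rightarrow> real) \<Rightarrow> bool" where
  "approx_equiv g h \<longleftrightarrow> (\<exists>c>0. \<exists>C>0. \<forall>t>0. c * h t \<le> g t \<and> g t \<le> C * h t)"

text \<open>Only the values on the positive half-line matter, also in the sequel.\<close>

definition slowly_varying :: "(real \<Rightarrow> real) \<Rightarrow> bool" where
  "slowly_varying b \<longleftrightarrow>
     b \<in> borel_measurable (lebesgue_on {0<..}) \<and>
     (\<forall>t>0. 0 < b t) \<and>
     (\<forall>\<epsilon>>0. \<exists>b1 b2. mono_on {0<..} b1 \<and> antimono_on {0<..} b2 \<and>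
        approx_equiv (\<lambda>t. t powr \<epsilon> * b t) b1 \<and>
        approx_equiv (\<lambda>t. t powr (- \<epsilon>) * b t) b2)"

text \<open>The functionals of \<open>L\<^sup>p\<^sup>,\<^sup>q\<^sup>,\<^sup>b\<close> (with \<open>f\<^sup>*\<close>) and \<open>L\<^sup>(\<^sup>p\<^sup>,\<^sup>q\<^sup>,\<^sup>b\<^sup>)\<close> (with \<open>f\<^sup>*\<^sup>*\<close>).\<close>

definition LK_norm :: "'a measure \<Rightarrow> ennreal \<Rightarrow> ennreal \<Rightarrow> (real \<Rightarrow> real) \<Rightarrow>
    ('a \<Rightarrow> ecomplex) \<Rightarrow> ennreal" where
  "LK_norm \<mu> p q b f =
     Lq_norm q (\<lambda>t. ennreal (t powr (recip p - recip q) * b t) * rearr \<mu> f t)"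

definition LK_max_norm :: "'a measure \<Rightarrow> ennreal \<Rightarrow> ennreal \<Rightarrow> (real \<Rightarrow> real) \<Rightarrow>
    ('a \<Rightarrow> ecomplex) \<Rightarrow> ennreal" where
  "LK_max_norm \<mu> p q b f =
     Lq_norm q (\<lambda>t. ennreal (t powr (recip p - recip q) * b t) * max_rearr \<mu> f t)"

definition space_of :: "'a measure \<Rightarrow> (('a \<Rightarrow> ecomplex) \<Rightarrow> ennreal) \<Rightarrow> ('a \<Rightarrow> ecomplex) set" where
  "space_of \<mu> N = {f \<in> mfun \<mu>. N f < \<infinity>}"

text \<open>The modulus of a product is the product of the moduli, with \<open>0 * \<infinity> = 0\<close>.\<close>

definition associate_norm :: "'a measure \<Rightarrow> (('a \<Rightarrow> ecomplex) \<Rightarrow> ennreal) \<Rightarrow>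
    ('a \<Rightarrow> ecomplex) \<Rightarrow> ennreal" where
  "associate_norm \<mu> N f =
     (SUP g\<in>{g \<in> mfun \<mu>. N g \<le> 1}. \<integral>\<^sup>+x. emod (f x) * emod (g x) \<partial>\<mu>)"

definition equal_up_to_equivalence :: "'a measure \<Rightarrow> (('a \<Rightarrow> ecomplex) \<Rightarrow> ennreal) \<Rightarrow>
    (('a \<Rightarrow> ecomplex) \<Rightarrow> ennreal) \<Rightarrow> bool" where
  "equal_up_to_equivalence \<mu> N1 N2 \<longleftrightarrow>
     space_of \<mu> N1 = space_of \<mu> N2 \<and>
     (\<exists>C::real>0. \<forall>f\<in>mfun \<mu>. N1 f \<le> ennreal C * N2 f \<and> N2 f \<le> ennreal C * N1 f)"

end

theory Submission
  imports Defs
begin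

text \<open>Let \<open>w(t) = (t\<^bsup>1/p - 1/q\<^esup> b(t))\<^sup>q\<close>, \<open>W(t) = \<integral>\<^sub>0\<^sup>t w\<close> and \<open>F(t) = \<integral>\<^sub>0\<^sup>t f\<^sup>*\<close>. In both cases the
  associate norm of \<open>f\<close> is equivalent to \<open>sup\<^sub>t W(t)\<^bsup>-1/q\<^esup> F(t)\<close>; slow variation gives
  \<open>W(t)\<^bsup>1/q\<^esup> \<approx> t\<^bsup>1/p\<^esup> b(t)\<close> if \<open>p < \<infinity>\<close>, and \<open>W\<^bsup>-1/q\<^esup> = a\<close> if \<open>p = \<infinity>\<close>.
  The lower bound tests with multiples of characteristic functions of sets of measure at most \<open>t\<close>.
  For the upper bound let \<open>m(v) = \<mu>{|g| > v}\<close>. Then \<open>\<integral>|f g| \<le> \<integral>\<^sub>0\<^sup>\<infinity> F(m(v)) dv\<close>, and \<open>F \<le> K W\<^bsup>1/q\<^esup>\<close>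
  reduces the claim to \<open>\<integral>\<^sub>0\<^sup>\<infinity> V(v)\<^bsup>1/q\<^esup> dv \<le> C (\<integral>\<^sub>0\<^sup>\<infinity> v\<^bsup>q-1\<^esup> V(v) dv)\<^bsup>1/q\<^esup>\<close> for the decreasing
  function \<open>V(v) = W(m(v))\<close>; the integral on the right is \<open>1/q \<integral> w (g\<^sup>*)\<^sup>q\<close> by Tonelli.\<close>

subsection \<open>Powers and layer cakes\<close>

lemma epowr_zero [simp]: "epowr 0 r = 0"
  by (simp add: epowr_def)

lemma epowr_ennreal: "0 \<le> c \<Longrightarrow> epowr (ennreal c) r = ennreal (c powr r)"
  by (simp add: epowr_def)

lemma epowr_mono:
  assumes "0 < r" "x \<le> y"
  shows "epowr x r \<le> epowr y r"
proof (cases "y = \<infinity>")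
  case False
  then obtain c where c: "0 \<le> c" "y = ennreal c" by (cases y) auto
  with assms(2) obtain d where "0 \<le> d" "x = ennreal d" "d \<le> c"
    by (cases x) (auto simp: top_unique)
  with assms c show ?thesis
    by (simp add: epowr_ennreal powr_mono2 ennreal_leI)
qed (simp add: epowr_def)

lemma epowr_one [simp]: "epowr x 1 = x"
  by (cases x) (auto simp: epowr_def)

lemma epowr_add:
  assumes "0 < r" "0 < s"
  shows "epowr x (r + s) = epowr x r * epowr x s"
  by (cases x) (auto simp: epowr_def powr_add ennreal_mult ennreal_top_mult)

lemma epowr_mult:
  assumes "0 < r"
  shows "epowr (x * y) r = epowr x r * epowr y r"
proof (cases "x = 0 \<or> y = 0 \<or> x = \<infinity> \<or> y = \<infinity>")
  case True
  then show ?thesis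
    by (cases x; cases y) (auto simp: epowr_def ennreal_mult_top ennreal_top_mult)
next
  case False
  then show ?thesis
    by (cases x; cases y) (auto simp: epowr_ennreal powr_mult simp flip: ennreal_mult)
qed

lemma borel_measurable_epowr [measurable (raw)]:
  assumes [measurable]: "f \<in> borel_measurable M"
  shows "(\<lambda>x. epowr (f x) r) \<in> borel_measurable M"
  unfolding epowr_def by measurable

text \<open>Superlevel sets of a monotone function are intervals. This settles measurability of
  rearrangements, of distribution functions and of \<open>cumul\<close>.\<close>

lemma borel_measurable_mono_ennreal:
  fixes f :: "real \<Rightarrow> ennreal"
  assumes "mono f \<or> antimono f"
  shows "f \<in> borel_measurable borel"
proof (rule borel_measurableI_greater)
  fix y
  have "is_interval {x. y < f x}"
    unfolding is_interval_1
    using assms by (auto simp: mono_def antimono_def intro: less_le_trans)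
  then show "{x \<in> space borel. y < f x} \<in> sets borel"
    by (simp add: real_interval_borel_measurable)
qed

section \<open>Initial segments of the half-line and layer-cake identities\<close>

abbreviation half_line :: "real measure" where
  "half_line \<equiv> lebesgue_on {0<..}"

text \<open>The bound is extended, so that measures of level sets and values of \<open>emod\<close>,
  possibly infinite, can be inserted directly. Since \<open>ennreal\<close> sends negative reals to
  0, positivity has to be demanded separately.\<close>

definition below :: "ennreal \<Rightarrow> real set" where
  "below m = {t. 0 < t \<and> ennreal t < m}"

lemma below_ennreal: "below (ennreal t) = {0<..<t}"
  by (auto simp: below_def ennreal_less_iff dest: less_trans)

lemma below_top: "below top = {0<..}"
  by (auto simp: below_def)

lemma below_mono: "m \<le> n \<Longrightarrow> below m \<subseteq> below n"
  by (auto simp: below_def)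

lemma indicator_below_mono: "m \<le> n \<Longrightarrow> (indicator (below m) t :: ennreal) \<le> indicator (below n) t"
  using below_mono[of m n] by (auto split: split_indicator)

lemma sets_below [measurable]: "below m \<in> sets borel"
  unfolding below_def by measurable

lemma measurable_indicator_below [measurable (raw)]:
  assumes [measurable]: "f \<in> borel_measurable M" "h \<in> borel_measurable M"
  shows "(\<lambda>x. indicator (below (h x)) (f x) :: ennreal) \<in> borel_measurable M"
proof -
  have "(\<lambda>x. indicator (below (h x)) (f x) :: ennreal) =
      (\<lambda>x. indicator {x. 0 < f x \<and> ennreal (f x) < h x} x)"
    by (auto simp: below_def indicator_def fun_eq_iff)
  then show ?thesis by simp
qed

text \<open>Completion does not change \<open>nn_integral\<close>. Computations can therefore move
  to \<open>lborel\<close>, where the power integrals and segment lengths are evaluated.\<close>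

lemma nn_integral_half_line:
  "(\<integral>\<^sup>+t. f t \<partial>half_line) = (\<integral>\<^sup>+t. f t * indicator {0<..} t \<partial>lborel)"
  by (subst nn_integral_restrict_space) (auto simp: nn_integral_completion)

lemma measurable_half_line: "f \<in> borel_measurable borel \<Longrightarrow> f \<in> borel_measurable half_line"
  by (intro measurable_restrict_space1 measurable_completion) simp

lemma sigma_finite_half_line: "sigma_finite_measure half_line"
proof (rule sigma_finite_measure_restrict_space)
  show "sigma_finite_measure (lebesgue :: real measure)"
  proof
    have "\<exists>n. x \<in> {- real n..real n}" for x
    proof -
      obtain n where "\<bar>x\<bar> \<le> real n" using real_arch_simple by blast
      then have "x \<in> {- real n..real n}" by simp linarith
      then show ?thesis by blast
    qed
    then have "(\<Union>n. {- real n..real n}) = UNIV" by blast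
    then show "\<exists>A::real set set. countable A \<and> A \<subseteq> sets lebesgue \<and> \<Union> A = space lebesgue \<and>
        (\<forall>a\<in>A. emeasure lebesgue a \<noteq> \<infinity>)"
      by (intro exI[of _ "range (\<lambda>n::nat. {- real n..real n})"]) auto
  qed
qed auto

lemma ennreal_eq_top_if_ge_real:
  assumes "\<And>x. 0 \<le> x \<Longrightarrow> ennreal x \<le> y"
  shows "y = \<infinity>"
proof (cases y)
  case (real c)
  with assms[of "c + 1"] show ?thesis by simp
qed simp

lemma nn_integral_below_powr:
  assumes "0 < \<alpha>"
  shows "(\<integral>\<^sup>+u. ennreal (u powr (\<alpha> - 1)) * indicator (below m) u \<partial>lborel)
    = ennreal (1 / \<alpha>) * epowr m \<alpha>"
proof -
  let ?I = "\<lambda>m. (\<integral>\<^sup>+u. ennreal (u powr (\<alpha> - 1)) * indicator (below m) u \<partial>lborel)"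
  have fin: "?I (ennreal c) = ennreal (c powr \<alpha> / \<alpha>)" if "0 \<le> c" for c
  proof -
    \<comment> \<open>The known power integral lives on the closed interval; the two endpoints are
      null sets.\<close>
    have "?I (ennreal c) = (\<integral>\<^sup>+u. ennreal (if u \<in> {0..c} then u powr (\<alpha> - 1) else 0) \<partial>lborel)"
      by (rule nn_integral_cong_AE, rule AE_mp[OF AE_lborel_singleton[of 0]],
          rule AE_mp[OF AE_lborel_singleton[of c]])
        (auto simp: below_ennreal indicator_def)
    also have "\<dots> = ennreal (c powr \<alpha> / \<alpha>)"
      by (rule nn_integral_has_integral_lborel, simp, simp, subst has_integral_restrict_UNIV)
        (use has_integral_powr_from_0[of "\<alpha> - 1" c] that assms in simp)
    finally show ?thesis .
  qed
  show ?thesis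
  proof (cases "m = \<infinity>")
    case True
    have "ennreal x \<le> ?I \<infinity>" if "0 \<le> x" for x
    proof -
      \<comment> \<open>The endpoint is the one at which the integral equals \<open>x\<close>
        exactly, so the integral over the whole half-line exceeds every real.\<close>
      have "ennreal x = ?I (ennreal ((\<alpha> * x) powr (1 / \<alpha>)))"
        using assms that by (subst fin) (auto simp: powr_powr)
      also have "\<dots> \<le> ?I \<infinity>"
        by (intro nn_integral_mono mult_left_mono indicator_below_mono) auto
      finally show ?thesis .
    qed
    then have "?I \<infinity> = \<infinity>"
      by (intro ennreal_eq_top_if_ge_real) auto
    with True show ?thesis using assms by (simp add: epowr_def ennreal_mult_top)
  next
    case False
    then obtain c where "0 \<le> c" "m = ennreal c" by (cases m) auto
    then show ?thesis using assms by (simp add: fin epowr_ennreal flip: ennreal_mult)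
  qed
qed

lemma nn_integral_below:
  "(\<integral>\<^sup>+u. indicator (below m) u \<partial>lborel) = m"
proof -
  have "(\<integral>\<^sup>+u. indicator (below m) u \<partial>lborel) =
      (\<integral>\<^sup>+u. ennreal (u powr (1 - 1)) * indicator (below m) u \<partial>lborel)"
    by (intro nn_integral_cong) (auto simp: below_def indicator_def)
  then show ?thesis by (simp only: nn_integral_below_powr) simp
qed

text \<open>Tonelli. The inner integral is the primitive of \<open>\<kappa>\<close> evaluated at
  \<open>h x\<close>: \<open>\<kappa> = 1\<close> gives \<open>h\<close> itself, and
  \<open>\<kappa> u = u powr (q - 1)\<close> gives its \<open>q\<close>-th power divided by
  \<open>q\<close>. Both kernels occur below.\<close>

lemma nn_integral_layer:
  assumes "sigma_finite_measure M"
    and [measurable]: "\<phi> \<in> borel_measurable M" "h \<in> borel_measurable M" "\<kappa> \<in> borel_measurable borel"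
  shows "(\<integral>\<^sup>+x. \<phi> x * (\<integral>\<^sup>+u. \<kappa> u * indicator (below (h x)) u \<partial>lborel) \<partial>M) =
    (\<integral>\<^sup>+u. \<kappa> u * (\<integral>\<^sup>+x. \<phi> x * indicator (below (h x)) u \<partial>M) \<partial>lborel)"
proof -
  interpret M: sigma_finite_measure M by fact
  interpret pair_sigma_finite M lborel ..
  have "(\<integral>\<^sup>+x. \<phi> x * (\<integral>\<^sup>+u. \<kappa> u * indicator (below (h x)) u \<partial>lborel) \<partial>M) =
      (\<integral>\<^sup>+x. (\<integral>\<^sup>+u. \<phi> x * (\<kappa> u * indicator (below (h x)) u) \<partial>lborel) \<partial>M)"
    by (intro nn_integral_cong nn_integral_cmult[symmetric]) simp
  also have "\<dots> = (\<integral>\<^sup>+u. (\<integral>\<^sup>+x. \<phi> x * (\<kappa> u * indicator (below (h x)) u) \<partial>M) \<partial>lborel)"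
    by (rule Fubini'[symmetric]) measurable
  also have "\<dots> = (\<integral>\<^sup>+u. (\<integral>\<^sup>+x. \<kappa> u * (\<phi> x * indicator (below (h x)) u) \<partial>M) \<partial>lborel)"
    by (simp add: ac_simps)
  also have "\<dots> = (\<integral>\<^sup>+u. \<kappa> u * (\<integral>\<^sup>+x. \<phi> x * indicator (below (h x)) u \<partial>M) \<partial>lborel)"
    by (intro nn_integral_cong nn_integral_cmult) simp
  finally show ?thesis .
qed

lemma nn_integral_layer_cake:
  assumes "sigma_finite_measure M"
    and [measurable]: "\<phi> \<in> borel_measurable M" "h \<in> borel_measurable M"
  shows "(\<integral>\<^sup>+x. \<phi> x * h x \<partial>M) = (\<integral>\<^sup>+u. (\<integral>\<^sup>+x. \<phi> x * indicator (below (h x)) u \<partial>M) \<partial>lborel)"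
  using nn_integral_layer[OF assms, of "\<lambda>_. 1"] by (simp add: nn_integral_below)

subsection \<open>Decreasing rearrangements\<close>

lemma measurable_emod [measurable]: "emod \<in> borel_measurable ecomplex_borel"
proof (rule measurableI)
  fix A :: "ennreal set" assume [measurable]: "A \<in> sets borel"
  have "Fin -` (emod -` A) = (\<lambda>z. ennreal (cmod z)) -` A \<inter> space borel"
    by auto
  also have "\<dots> \<in> sets borel" by measurable
  finally show "emod -` A \<inter> space ecomplex_borel \<in> sets ecomplex_borel"
    by (auto simp: ecomplex_borel_def)
qed simp

lemma measurable_Fin [measurable]: "Fin \<in> borel \<rightarrow>\<^sub>M ecomplex_borel"
  unfolding ecomplex_borel_def by (rule measurable_measure_of) auto

definition upper_level :: "'a measure \<Rightarrow> ('a \<Rightarrow> ecomplex) \<Rightarrow> real \<Rightarrow> 'a set" where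
  "upper_level \<mu> f u = {x \<in> space \<mu>. ennreal u < emod (f x)}"

lemma sets_upper_level [measurable]:
  assumes [measurable]: "f \<in> mfun \<mu>"
  shows "upper_level \<mu> f u \<in> sets \<mu>"
  unfolding upper_level_def by measurable

lemma upper_level_antimono: "u \<le> v \<Longrightarrow> upper_level \<mu> f v \<subseteq> upper_level \<mu> f u"
  by (auto simp: upper_level_def intro: le_less_trans ennreal_leI)

lemma rearr_eq:
  "rearr \<mu> f t = (INF s\<in>{s. 0 \<le> s \<and> emeasure \<mu> (upper_level \<mu> f s) \<le> ennreal t}. ennreal s)"
  by (simp add: rearr_def upper_level_def)

text \<open>The rearrangement is a generalized inverse of the distribution function. The strict form
  of the equivalence relies on right-continuity of the distribution function, which is continuity
  from below of \<open>\<mu>\<close> along growing level sets.\<close>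

lemma less_rearr_iff:
  assumes [measurable]: "f \<in> mfun \<mu>" and "0 \<le> u"
  shows "ennreal u < rearr \<mu> f t \<longleftrightarrow> ennreal t < emeasure \<mu> (upper_level \<mu> f u)"
proof -
  have "emeasure \<mu> (upper_level \<mu> f u) \<le> ennreal t" if "rearr \<mu> f t \<le> ennreal u"
  proof -
    \<comment> \<open>The infimum in \<open>rearr\<close> is not yet known to be attained at
      \<open>u\<close>, but every level slightly above \<open>u\<close> exceeds an admissible one;
      the union over \<open>n\<close> then recovers \<open>u\<close>.\<close>
    have le: "emeasure \<mu> (upper_level \<mu> f (u + 1 / Suc n)) \<le> ennreal t" for n
    proof -
      have "rearr \<mu> f t < ennreal (u + 1 / Suc n)"
        by (rule le_less_trans[OF that]) (use assms in \<open>simp add: ennreal_less_iff\<close>)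
      then obtain s where "0 \<le> s" "emeasure \<mu> (upper_level \<mu> f s) \<le> ennreal t" "s < u + 1 / Suc n"
        by (auto simp: rearr_eq INF_less_iff ennreal_less_iff)
      then show ?thesis
        using emeasure_mono[OF upper_level_antimono[of s "u + 1 / Suc n" \<mu> f] sets_upper_level]
        by (auto intro: order_trans)
    qed
    have "upper_level \<mu> f u = (\<Union>n. upper_level \<mu> f (u + 1 / Suc n))"
    proof (intro equalityI subsetI)
      fix x assume "x \<in> upper_level \<mu> f u"
      then have x: "x \<in> space \<mu>" "ennreal u < emod (f x)"
        by (auto simp: upper_level_def)
      then obtain v where v: "u < v" "ennreal v < emod (f x)"
        using dense[OF x(2)] assms(2) by (metis ennreal_cases ennreal_less_iff top.not_eq_extremum order_less_imp_not_less)
      obtain n where "1 / Suc n < v - u"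
        using v(1) nat_approx_posE[of "v - u"] by auto
      then have "u + 1 / Suc n \<le> v" by simp
      from le_less_trans[OF ennreal_leI[OF this] v(2)] x(1)
      show "x \<in> (\<Union>n. upper_level \<mu> f (u + 1 / Suc n))"
        by (auto simp: upper_level_def)
    qed (use upper_level_antimono[of u "u + 1 / Suc _" \<mu> f] in force)
    moreover have "incseq (\<lambda>n. upper_level \<mu> f (u + 1 / Suc n))"
      by (intro incseq_SucI upper_level_antimono) (simp add: field_simps)
    ultimately have "emeasure \<mu> (upper_level \<mu> f u) =
        (SUP n. emeasure \<mu> (upper_level \<mu> f (u + 1 / Suc n)))"
      by (subst SUP_emeasure_incseq) auto
    also have "\<dots> \<le> ennreal t" by (rule SUP_least) (rule le)
    finally show ?thesis .
  qed
  moreover have "rearr \<mu> f t \<le> ennreal u" if "emeasure \<mu> (upper_level \<mu> f u) \<le> ennreal t"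
    unfolding rearr_eq using that assms(2) by (intro INF_lower) simp
  ultimately show ?thesis by (meson not_less)
qed

lemma antimono_rearr: "antimono (rearr \<mu> f)"
  unfolding rearr_eq
  by (intro antimonoI INF_superset_mono) (auto intro: order_trans ennreal_leI)

lemma measurable_rearr [measurable]: "rearr \<mu> f \<in> borel_measurable borel"
  by (simp add: borel_measurable_mono_ennreal antimono_rearr)

lemma measurable_rearr_half_line [measurable]: "rearr \<mu> f \<in> borel_measurable half_line"
  by (simp add: measurable_half_line)

text \<open>For \<open>w = rearr \<mu> f\<close> this is the function \<open>F\<close> of the
  overview, for the weight it is \<open>W\<close>. The argument is extended because measures of
  level sets are inserted, and these may be infinite.\<close>

definition cumul :: "(real \<Rightarrow> ennreal) \<Rightarrow> ennreal \<Rightarrow> ennreal" where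
  "cumul w m = (\<integral>\<^sup>+t. w t * indicator (below m) t \<partial>half_line)"

lemma cumul_mono: "m \<le> n \<Longrightarrow> cumul w m \<le> cumul w n"
  unfolding cumul_def by (intro nn_integral_mono mult_left_mono indicator_below_mono) auto

lemma cumul_ennreal: "cumul w (ennreal t) = (\<integral>\<^sup>+s\<in>{0<..<t}. w s \<partial>lebesgue)"
  unfolding cumul_def below_ennreal
  by (subst nn_integral_restrict_space) (auto intro!: nn_integral_cong simp: indicator_def)

lemma measurable_cumul [measurable]: "(\<lambda>t. cumul w (ennreal t)) \<in> borel_measurable borel"
  by (intro borel_measurable_mono_ennreal disjI1 monoI cumul_mono ennreal_leI)

lemma max_rearr_eq: "max_rearr \<mu> f t = ennreal (1 / t) * cumul (rearr \<mu> f) (ennreal t)"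
  by (simp add: max_rearr_def cumul_ennreal)

text \<open>Layer cake for \<open>rearr \<mu> f\<close>: by \<open>less_rearr_iff\<close> the points
  of \<open>below m\<close> at which the rearrangement exceeds \<open>u\<close> form the segment up
  to the smaller of \<open>m\<close> and the measure of the level set.\<close>

lemma cumul_rearr:
  assumes [measurable]: "f \<in> mfun \<mu>"
  shows "cumul (rearr \<mu> f) m =
    (\<integral>\<^sup>+u. indicator {0<..} u * min m (emeasure \<mu> (upper_level \<mu> f u)) \<partial>lborel)"
proof -
  have "cumul (rearr \<mu> f) m = (\<integral>\<^sup>+t. indicator (below m) t * rearr \<mu> f t \<partial>half_line)"
    by (simp add: cumul_def mult.commute)
  also have "\<dots> = (\<integral>\<^sup>+u. (\<integral>\<^sup>+t. indicator (below m) t *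
      indicator (below (rearr \<mu> f t)) u \<partial>half_line) \<partial>lborel)"
    by (rule nn_integral_layer_cake[OF sigma_finite_half_line]) (auto intro!: measurable_half_line)
  also have "\<dots> = (\<integral>\<^sup>+u. indicator {0<..} u * min m (emeasure \<mu> (upper_level \<mu> f u)) \<partial>lborel)"
  proof (rule nn_integral_cong)
    fix u :: real
    let ?d = "emeasure \<mu> (upper_level \<mu> f u)"
    have "(\<integral>\<^sup>+t. indicator (below m) t * indicator (below (rearr \<mu> f t)) u \<partial>half_line) =
        (\<integral>\<^sup>+t. indicator {0<..} u * indicator (below (min m ?d)) t \<partial>lborel)"
      unfolding nn_integral_half_line
      by (rule nn_integral_cong) (auto simp: below_def less_rearr_iff indicator_def)
    also have "\<dots> = indicator {0<..} u * min m ?d"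
      by (simp add: nn_integral_cmult nn_integral_below)
    finally show "(\<integral>\<^sup>+t. indicator (below m) t * indicator (below (rearr \<mu> f t)) u \<partial>half_line) =
        indicator {0<..} u * min m ?d" .
  qed
  finally show ?thesis .
qed

text \<open>Brings integrals over sets into the same form as \<open>cumul_rearr\<close>, so that the
  two can be compared level by level.\<close>

lemma nn_integral_emod_set:
  assumes "sigma_finite_measure \<mu>" and [measurable]: "f \<in> mfun \<mu>" "E \<in> sets \<mu>"
  shows "(\<integral>\<^sup>+x. indicator E x * emod (f x) \<partial>\<mu>) =
    (\<integral>\<^sup>+u. indicator {0<..} u * emeasure \<mu> (E \<inter> upper_level \<mu> f u) \<partial>lborel)"
proof -
  have "(\<integral>\<^sup>+x. indicator E x * emod (f x) \<partial>\<mu>) =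
      (\<integral>\<^sup>+u. (\<integral>\<^sup>+x. indicator E x * indicator (below (emod (f x))) u \<partial>\<mu>) \<partial>lborel)"
    by (rule nn_integral_layer_cake) (use assms in measurable)
  also have "(\<lambda>u. \<integral>\<^sup>+x. indicator E x * indicator (below (emod (f x))) u \<partial>\<mu>) =
      (\<lambda>u. \<integral>\<^sup>+x. indicator {0<..} u * indicator (E \<inter> upper_level \<mu> f u) x \<partial>\<mu>)"
    by (intro ext nn_integral_cong) (auto simp: below_def upper_level_def split: split_indicator)
  also have "\<dots> = (\<lambda>u. indicator {0<..} u * emeasure \<mu> (E \<inter> upper_level \<mu> f u))"
    by (simp add: nn_integral_cmult_indicator)
  finally show ?thesis .
qed

text \<open>At each level, the measure of an intersection is at most the smaller of the two
  measures.\<close>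

lemma nn_integral_emod_set_le:
  assumes "sigma_finite_measure \<mu>" and [measurable]: "f \<in> mfun \<mu>" "E \<in> sets \<mu>"
  shows "(\<integral>\<^sup>+x. indicator E x * emod (f x) \<partial>\<mu>) \<le> cumul (rearr \<mu> f) (emeasure \<mu> E)"
  unfolding nn_integral_emod_set[OF assms] cumul_rearr[OF assms(2)]
  by (intro nn_integral_mono mult_left_mono min.boundedI emeasure_mono) auto

text \<open>Cutting \<open>g\<close> into layers leaves integrals of \<open>f\<close> over the level
  sets of \<open>g\<close>, each of which is bounded by
  \<open>nn_integral_emod_set_le\<close>.\<close>

lemma nn_integral_emod_mult_le:
  assumes "sigma_finite_measure \<mu>" and [measurable]: "f \<in> mfun \<mu>" "g \<in> mfun \<mu>"
  shows "(\<integral>\<^sup>+x. emod (f x) * emod (g x) \<partial>\<mu>) \<le>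
    (\<integral>\<^sup>+v. indicator {0<..} v * cumul (rearr \<mu> f) (emeasure \<mu> (upper_level \<mu> g v)) \<partial>lborel)"
proof -
  have "(\<integral>\<^sup>+x. emod (f x) * emod (g x) \<partial>\<mu>) =
      (\<integral>\<^sup>+v. (\<integral>\<^sup>+x. emod (f x) * indicator (below (emod (g x))) v \<partial>\<mu>) \<partial>lborel)"
    by (rule nn_integral_layer_cake) (use assms in measurable)
  also have "\<dots> = (\<integral>\<^sup>+v. (\<integral>\<^sup>+x. indicator {0<..} v *
      (indicator (upper_level \<mu> g v) x * emod (f x)) \<partial>\<mu>) \<partial>lborel)"
    by (intro nn_integral_cong) (auto simp: below_def upper_level_def split: split_indicator)
  also have "\<dots> = (\<integral>\<^sup>+v. indicator {0<..} v *
      (\<integral>\<^sup>+x. indicator (upper_level \<mu> g v) x * emod (f x) \<partial>\<mu>) \<partial>lborel)"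
    by (intro nn_integral_cong nn_integral_cmult) measurable
  also have "\<dots> \<le> (\<integral>\<^sup>+v. indicator {0<..} v * cumul (rearr \<mu> f) (emeasure \<mu> (upper_level \<mu> g v)) \<partial>lborel)"
    by (intro nn_integral_mono mult_left_mono nn_integral_emod_set_le assms) auto
  finally show ?thesis .
qed

text \<open>The formula of \<open>cumul_rearr\<close> is split at the level \<open>l\<close>. For
  \<open>u \<ge> l\<close> the level set lies inside the one at \<open>l\<close> and contributes to
  the set integral; the levels \<open>u < l\<close> contribute at most \<open>t\<close>
  each.\<close>

lemma cumul_rearr_le:
  assumes "sigma_finite_measure \<mu>" and [measurable]: "f \<in> mfun \<mu>"
    and "0 \<le> l" "rearr \<mu> f t = ennreal l"
  shows "cumul (rearr \<mu> f) (ennreal t) \<le>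
    (\<integral>\<^sup>+x. indicator (upper_level \<mu> f l) x * emod (f x) \<partial>\<mu>) + ennreal t * ennreal l"
proof -
  let ?A = "upper_level \<mu> f l"
  have "cumul (rearr \<mu> f) (ennreal t) \<le> (\<integral>\<^sup>+u. indicator {0<..} u * emeasure \<mu> (?A \<inter> upper_level \<mu> f u)
      + ennreal t * indicator (below (ennreal l)) u \<partial>lborel)"
    unfolding cumul_rearr[OF assms(2)]
  proof (rule nn_integral_mono)
    fix u
    show "indicator {0<..} u * min (ennreal t) (emeasure \<mu> (upper_level \<mu> f u)) \<le>
      indicator {0<..} u * emeasure \<mu> (?A \<inter> upper_level \<mu> f u) + ennreal t * indicator (below (ennreal l)) u"
    proof (cases "u < l")
      case False
      then have "?A \<inter> upper_level \<mu> f u = upper_level \<mu> f u"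
        using upper_level_antimono[of l u \<mu> f] by auto
      then show ?thesis by (auto split: split_indicator intro: min.coboundedI2 add_increasing2)
    qed (auto simp: below_ennreal split: split_indicator intro: min.coboundedI1 add_increasing)
  qed
  also have "\<dots> = (\<integral>\<^sup>+u. indicator {0<..} u * emeasure \<mu> (?A \<inter> upper_level \<mu> f u) \<partial>lborel)
      + (\<integral>\<^sup>+u. ennreal t * indicator (below (ennreal l)) u \<partial>lborel)"
  proof (rule nn_integral_add)
    have "antimono (\<lambda>u. emeasure \<mu> (?A \<inter> upper_level \<mu> f u))"
      using upper_level_antimono[of _ _ \<mu> f] by (intro antimonoI emeasure_mono) auto
    then show "(\<lambda>u. indicator {0<..} u * emeasure \<mu> (?A \<inter> upper_level \<mu> f u)) \<in> borel_measurable lborel"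
      using borel_measurable_mono_ennreal by (intro borel_measurable_times_ennreal) auto
  qed auto
  also have "\<dots> = (\<integral>\<^sup>+x. indicator ?A x * emod (f x) \<partial>\<mu>) + ennreal t * ennreal l"
    by (subst nn_integral_emod_set[OF assms(1)]) (auto simp: nn_integral_cmult nn_integral_below)
  finally show ?thesis .
qed

subsection \<open>The upper bound\<close>

text \<open>Continuity from below of the measure with density \<open>w\<close>; it carries bounds at
  finite arguments over to \<open>m = \<infinity>\<close>.\<close>

lemma cumul_le_if_le_below:
  assumes [measurable]: "w \<in> borel_measurable half_line"
    and le: "\<And>t. 0 < t \<Longrightarrow> ennreal t < m \<Longrightarrow> cumul w (ennreal t) \<le> X"
  shows "cumul w m \<le> X"
proof -
  \<comment> \<open>Real numbers approaching \<open>m\<close> from below. Nonpositive terms are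
    tolerated because their segments are empty.\<close>
  obtain r :: "nat \<Rightarrow> real" where r: "incseq r" "\<And>n. ennreal (r n) < m \<or> r n \<le> 0"
    and U: "below m = (\<Union>n. below (ennreal (r n)))"
  proof (cases "m = \<infinity>")
    case True
    have "below m = (\<Union>n. below (ennreal (real n)))"
    proof (intro equalityI subsetI)
      fix x assume "x \<in> below m"
      moreover obtain n where "x < real n" using reals_Archimedean2 by blast
      ultimately show "x \<in> (\<Union>n. below (ennreal (real n)))"
        by (auto simp: below_def ennreal_less_iff)
    qed (auto simp: True below_ennreal below_top)
    with True that[of real] show ?thesis by (auto simp: incseq_def)
  next
    case False
    then obtain c where c: "0 \<le> c" "m = ennreal c" by (cases m) auto
    have "\<exists>n. t < c - 1 / Suc n" if "t < c" for t
      using nat_approx_posE[of "c - t"] that by (auto simp: algebra_simps)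
    then have "below m = (\<Union>n. below (ennreal (c - 1 / Suc n)))"
      by (fastforce simp: c below_ennreal intro: less_trans)
    moreover have "incseq (\<lambda>n. c - 1 / Suc n)"
      by (intro incseq_SucI) (simp add: field_simps)
    moreover have "ennreal (c - 1 / Suc n) < m \<or> c - 1 / Suc n \<le> 0" for n
      by (auto simp: c ennreal_less_iff not_le)
    ultimately show ?thesis using that by blast
  qed
  let ?D = "density half_line w"
  have D: "cumul w n = emeasure ?D (below n)" for n
  proof -
    have "below n \<in> sets half_line"
      by (auto simp: sets_restrict_space_iff below_def[of n] sets_below[unfolded below_def])
    then show ?thesis by (simp add: cumul_def emeasure_density)
  qed
  have "incseq (\<lambda>n. below (ennreal (r n)))"
    using r(1) by (intro monoI below_mono ennreal_leI) (auto dest: incseqD)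
  moreover have "below (ennreal s) \<in> sets half_line" for s
    by (auto simp: below_ennreal sets_restrict_space_iff)
  ultimately have "cumul w m = (SUP n. cumul w (ennreal (r n)))"
    unfolding D U by (subst SUP_emeasure_incseq) auto
  also have "\<dots> \<le> X"
  proof (rule SUP_least)
    fix n
    show "cumul w (ennreal (r n)) \<le> X"
    proof (cases "0 < r n")
      case True
      with r(2)[of n] show ?thesis by (intro le) auto
    qed (simp add: cumul_def below_ennreal)
  qed
  finally show ?thesis .
qed

text \<open>A nonempty open interval has positive measure and so cannot lie in the exceptional null
  set.\<close>

lemma AE_half_line_ex:
  assumes "AE s in half_line. P s" and "0 \<le> t" "t < t'"
  shows "\<exists>s. t < s \<and> s < t' \<and> P s"
proof (rule ccontr)
  assume *: "\<not> ?thesis"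
  obtain N where N: "{s \<in> space half_line. \<not> P s} \<subseteq> N" "emeasure half_line N = 0" "N \<in> sets half_line"
    using AE_E[OF assms(1)] .
  have "{t<..<t'} \<subseteq> N" using * N(1) assms(2) by auto
  with N have "emeasure half_line {t<..<t'} \<le> 0"
    by (metis emeasure_mono)
  moreover have "emeasure half_line {t<..<t'} = emeasure lborel {t<..<t'}"
    using assms(2) by (subst emeasure_restrict_space) auto
  ultimately show False using assms(3) by simp
qed

text \<open>An essential supremum controls only almost every \<open>t\<close>, whereas the upper
  bound needs every measure \<open>m\<close> of a level set. Monotonicity on both sides and
  continuity from below close the gap.\<close>

lemma cumul_le_if_AE:
  assumes "w \<in> borel_measurable half_line" "mono G"
    and ae: "AE t in half_line. cumul w (ennreal t) \<le> G (ennreal t)"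
  shows "cumul w m \<le> G m"
proof (rule cumul_le_if_le_below)
  fix t :: real assume t: "0 < t" "ennreal t < m"
  \<comment> \<open>Room between \<open>t\<close> and \<open>m\<close> is needed to find a
    non-exceptional \<open>s\<close> there.\<close>
  then obtain t' where t': "t < t'" "ennreal t' < m"
    using dense[OF t(2)] by (metis ennreal_cases ennreal_less_iff less_imp_le top.not_eq_extremum order_less_imp_not_less)
  obtain s where s: "t < s" "s < t'" "cumul w (ennreal s) \<le> G (ennreal s)"
    using AE_half_line_ex[OF ae _ t'(1)] t by auto
  have "cumul w (ennreal t) \<le> cumul w (ennreal s)"
    using s by (intro cumul_mono ennreal_leI) auto
  also note s(3)
  also have "G (ennreal s) \<le> G m"
  proof (rule monoD[OF \<open>mono G\<close>])
    have "ennreal s \<le> ennreal t'" using s by (intro ennreal_leI) simp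
    with t'(2) show "ennreal s \<le> m" by simp
  qed
  finally show "cumul w (ennreal t) \<le> G m" .
qed fact

text \<open>The exponent \<open>q \<le> 1\<close> enters through the bound \<open>v\<^sup>q V(v) \<le> q J\<close>, which allows
  the surplus power of \<open>V\<close> to be traded for a power of \<open>v\<close>.\<close>

lemma nn_integral_antimono_powr_le:
  assumes "antimono V" "0 < q" "q \<le> 1"
  defines "J \<equiv> (\<integral>\<^sup>+v. ennreal (v powr (q - 1)) * (indicator {0<..} v * V v) \<partial>lborel)"
  shows "(\<integral>\<^sup>+v. indicator {0<..} v * epowr (V v) (1 / q) \<partial>lborel)
    \<le> ennreal (1 / q) * epowr (ennreal q * J) (1 / q)"
\<comment> \<open>For \<open>q = 1\<close> the surplus exponent \<open>1 / q - 1\<close> vanishes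
  and the two sides are the same integral.\<close>
proof (cases "q = 1")
  case True
  then show ?thesis
    by (auto simp: J_def intro!: nn_integral_mono split: split_indicator)
next
  case False
  with assms have q: "0 < q" "q < 1" by auto
  have [measurable]: "V \<in> borel_measurable borel"
    using assms(1) by (intro borel_measurable_mono_ennreal) auto
  \<comment> \<open>This is what remains of the surplus power of \<open>V v\<close> once its
    dependence on \<open>v\<close> has been split off.\<close>
  define C where "C = epowr (ennreal q * J) (1 / q - 1)"
  \<comment> \<open>Since \<open>V\<close> decreases, \<open>V v\<close> times the integral of
    \<open>u powr (q - 1)\<close> over \<open>(0, v)\<close> is a lower bound for
    \<open>J\<close>.\<close>
  have V: "ennreal (v powr q) * V v \<le> ennreal q * J" if "0 < v" for v
  proof -
    have "ennreal (1 / q) * (ennreal (v powr q) * V v) =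
        (\<integral>\<^sup>+u. ennreal (u powr (q - 1)) * indicator (below (ennreal v)) u \<partial>lborel) * V v"
      using q that by (simp add: nn_integral_below_powr epowr_ennreal mult.assoc)
    also have "\<dots> = (\<integral>\<^sup>+u. ennreal (u powr (q - 1)) * indicator (below (ennreal v)) u * V v \<partial>lborel)"
      by (rule nn_integral_multc[symmetric]) simp
    also have "\<dots> \<le> J"
      unfolding J_def using antimonoD[OF assms(1)]
      by (intro nn_integral_mono) (auto simp: below_ennreal split: split_indicator intro!: mult_left_mono)
    finally have "ennreal q * (ennreal (1 / q) * (ennreal (v powr q) * V v)) \<le> ennreal q * J"
      by (rule mult_left_mono) simp
    moreover have "ennreal q * ennreal (1 / q) = 1"
      using q by (simp flip: ennreal_mult)
    ultimately show ?thesis by (simp flip: mult.assoc)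
  qed
  \<comment> \<open>One factor \<open>V v\<close> is kept and only the remaining power
    \<open>1 / q - 1\<close> is estimated; the exponent \<open>- q * (1 / q - 1) = q - 1\<close>
    then reproduces the integrand of \<open>J\<close>.\<close>
  have point: "epowr (V v) (1 / q) \<le> ennreal (v powr (q - 1)) * V v * C" if "0 < v" for v
  proof -
    have "V v = ennreal (v powr (-q)) * (ennreal (v powr q) * V v)"
      using that by (simp add: powr_minus flip: mult.assoc ennreal_mult)
    also have "\<dots> \<le> ennreal (v powr (-q)) * (ennreal q * J)"
      by (intro mult_left_mono V that) simp
    finally have "epowr (V v) (1 / q - 1) \<le> epowr (ennreal (v powr (-q)) * (ennreal q * J)) (1 / q - 1)"
      using q by (intro epowr_mono) auto
    also have "\<dots> = ennreal (v powr (q - 1)) * C"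
    proof -
      have "- q * (1 / q - 1) = q - 1" using q by (simp add: field_simps)
      with q show ?thesis by (simp add: epowr_mult[of "1 / q - 1"] C_def epowr_ennreal powr_powr)
    qed
    finally have *: "epowr (V v) (1 / q - 1) \<le> ennreal (v powr (q - 1)) * C" .
    have "epowr (V v) (1 / q) = V v * epowr (V v) (1 / q - 1)"
      using q epowr_add[of 1 "1 / q - 1" "V v"] by simp
    also have "\<dots> \<le> V v * (ennreal (v powr (q - 1)) * C)"
      by (intro mult_left_mono *) simp
    finally show ?thesis by (simp add: ac_simps)
  qed
  have "(\<integral>\<^sup>+v. indicator {0<..} v * epowr (V v) (1 / q) \<partial>lborel) \<le>
      (\<integral>\<^sup>+v. ennreal (v powr (q - 1)) * (indicator {0<..} v * V v) * C \<partial>lborel)"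
    by (intro nn_integral_mono) (auto intro: point split: split_indicator)
  also have "\<dots> = J * C"
    unfolding J_def by (intro nn_integral_multc) simp
  also have "\<dots> = ennreal (1 / q) * (ennreal q * J * C)"
    using q by (simp flip: ennreal_mult mult.assoc)
  also have "ennreal q * J * C = epowr (ennreal q * J) (1 / q)"
    using q epowr_add[of 1 "1 / q - 1" "ennreal q * J"] by (simp add: C_def)
  finally show ?thesis .
qed

text \<open>By \<open>less_rearr_iff\<close>, \<open>s\<close> lies below the measure of the level
  set at \<open>v\<close> exactly when \<open>v\<close> lies below \<open>rearr \<mu> g s\<close>.
  Then \<open>nn_integral_layer\<close> with kernel \<open>v powr (q - 1)\<close> applies, and the
  factor \<open>q\<close> cancels the \<open>1 / q\<close> of the power integral.\<close>

lemma nn_integral_weight_powr_rearr: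
  assumes [measurable]: "g \<in> mfun \<mu>" "w \<in> borel_measurable half_line" and "0 < q"
  shows "ennreal q * (\<integral>\<^sup>+v. ennreal (v powr (q - 1)) *
      (indicator {0<..} v * cumul w (emeasure \<mu> (upper_level \<mu> g v))) \<partial>lborel) =
    (\<integral>\<^sup>+s. w s * epowr (rearr \<mu> g s) q \<partial>half_line)"
proof -
  have "(\<integral>\<^sup>+v. ennreal (v powr (q - 1)) *
      (indicator {0<..} v * cumul w (emeasure \<mu> (upper_level \<mu> g v))) \<partial>lborel) =
    (\<integral>\<^sup>+v. ennreal (v powr (q - 1)) *
      (\<integral>\<^sup>+s. w s * indicator (below (rearr \<mu> g s)) v \<partial>half_line) \<partial>lborel)"
  proof (rule nn_integral_cong)
    fix v :: real
    have "indicator {0<..} v * cumul w (emeasure \<mu> (upper_level \<mu> g v)) =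
        (\<integral>\<^sup>+s. indicator {0<..} v * (w s * indicator (below (emeasure \<mu> (upper_level \<mu> g v))) s) \<partial>half_line)"
      unfolding cumul_def
      by (intro nn_integral_cmult[symmetric] borel_measurable_times_ennreal assms(2) measurable_half_line) simp
    also have "\<dots> = (\<integral>\<^sup>+s. w s * indicator (below (rearr \<mu> g s)) v \<partial>half_line)"
      by (rule nn_integral_cong) (auto simp: below_def less_rearr_iff indicator_def)
    finally show "ennreal (v powr (q - 1)) *
        (indicator {0<..} v * cumul w (emeasure \<mu> (upper_level \<mu> g v))) =
      ennreal (v powr (q - 1)) * (\<integral>\<^sup>+s. w s * indicator (below (rearr \<mu> g s)) v \<partial>half_line)"
      by simp
  qed
  also have "\<dots> = (\<integral>\<^sup>+s. w s * (\<integral>\<^sup>+v. ennreal (v powr (q - 1)) *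
      indicator (below (rearr \<mu> g s)) v \<partial>lborel) \<partial>half_line)"
    by (rule nn_integral_layer[symmetric, OF sigma_finite_half_line]) auto
  also have "\<dots> = (\<integral>\<^sup>+s. ennreal (1 / q) * (w s * epowr (rearr \<mu> g s) q) \<partial>half_line)"
    using assms(3) by (simp add: nn_integral_below_powr ac_simps)
  also have "\<dots> = ennreal (1 / q) * (\<integral>\<^sup>+s. w s * epowr (rearr \<mu> g s) q \<partial>half_line)"
    by (rule nn_integral_cmult) simp
  finally show ?thesis
    using assms(3) by (simp flip: mult.assoc ennreal_mult)
qed

text \<open>\<open>nn_integral_antimono_powr_le\<close> is applied to \<open>W\<close> composed with
  the distribution function of \<open>g\<close>. The constant \<open>K\<close> is extended because
  it will contain a possibly infinite norm of \<open>f\<close>.\<close>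

lemma nn_integral_emod_mult_le_weighted:
  assumes "sigma_finite_measure \<mu>" and [measurable]: "f \<in> mfun \<mu>" "g \<in> mfun \<mu>"
    and w: "w \<in> borel_measurable half_line" and q: "0 < q" "q \<le> 1"
    and le: "\<And>m. cumul (rearr \<mu> f) m \<le> K * epowr (cumul w m) (1 / q)"
  shows "(\<integral>\<^sup>+x. emod (f x) * emod (g x) \<partial>\<mu>) \<le>
    K * (ennreal (1 / q) * epowr (\<integral>\<^sup>+s. w s * epowr (rearr \<mu> g s) q \<partial>half_line) (1 / q))"
proof -
  let ?V = "\<lambda>v. cumul w (emeasure \<mu> (upper_level \<mu> g v))"
  have V: "antimono ?V"
    by (intro antimonoI cumul_mono emeasure_mono upper_level_antimono) auto
  then have [measurable]: "?V \<in> borel_measurable borel"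
    by (intro borel_measurable_mono_ennreal) auto
  have "(\<integral>\<^sup>+x. emod (f x) * emod (g x) \<partial>\<mu>) \<le>
      (\<integral>\<^sup>+v. indicator {0<..} v * cumul (rearr \<mu> f) (emeasure \<mu> (upper_level \<mu> g v)) \<partial>lborel)"
    by (intro nn_integral_emod_mult_le assms)
  also have "\<dots> \<le> (\<integral>\<^sup>+v. K * (indicator {0<..} v * epowr (?V v) (1 / q)) \<partial>lborel)"
    by (intro nn_integral_mono) (auto intro: le split: split_indicator)
  also have "\<dots> = K * (\<integral>\<^sup>+v. indicator {0<..} v * epowr (?V v) (1 / q) \<partial>lborel)"
    by (rule nn_integral_cmult) simp
  also have "\<dots> \<le> K * (ennreal (1 / q) * epowr (\<integral>\<^sup>+s. w s * epowr (rearr \<mu> g s) q \<partial>half_line) (1 / q))"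
    using nn_integral_antimono_powr_le[OF V q] w q
    by (intro mult_left_mono) (simp_all add: nn_integral_weight_powr_rearr)
  finally show ?thesis .
qed

subsection \<open>The lower bound\<close>

lemma nonatomic_halve:
  assumes "nonatomic \<mu>" "A \<in> sets \<mu>" "0 < emeasure \<mu> A" "emeasure \<mu> A \<le> ennreal a"
  shows "\<exists>B\<in>sets \<mu>. B \<subseteq> A \<and> 0 < emeasure \<mu> B \<and> emeasure \<mu> B \<le> ennreal (a / 2)"
proof -
  obtain B where [measurable]: "B \<in> sets \<mu>"
    and B: "B \<subseteq> A" "0 < emeasure \<mu> B" "emeasure \<mu> B < emeasure \<mu> A"
    using assms(1-3) unfolding nonatomic_def by blast
  have [measurable]: "A \<in> sets \<mu>" by fact
  have sum: "emeasure \<mu> A = emeasure \<mu> B + emeasure \<mu> (A - B)"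
    using B(1) by (subst plus_emeasure) (auto simp: Un_absorb1)
  then have D: "0 < emeasure \<mu> (A - B)"
    using B(3) by (cases "emeasure \<mu> (A - B) = 0") (auto simp: zero_less_iff_neq_zero)
  \<comment> \<open>Both pieces have positive measure and together at most \<open>a\<close>, so one
    of them has at most half.\<close>
  have "emeasure \<mu> B \<le> ennreal (a / 2) \<or> emeasure \<mu> (A - B) \<le> ennreal (a / 2)"
  proof (rule ccontr)
    assume *: "\<not> ?thesis"
    have "0 < ennreal a" using assms(3,4) by (rule less_le_trans)
    then have a: "0 < a" by simp
    have "ennreal a = ennreal (a / 2) + ennreal (a / 2)"
      using a by (simp flip: ennreal_plus)
    also have "\<dots> < emeasure \<mu> B + emeasure \<mu> (A - B)"
      using * by (intro add_strict_mono) auto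
    finally show False using sum assms(4) by simp
  qed
  then show ?thesis using B D by (metis Diff_subset \<open>A \<in> sets \<mu>\<close> \<open>B \<in> sets \<mu>\<close> sets.Diff)
qed

text \<open>Repeated halving drives the measure below \<open>e\<close> while keeping it
  positive.\<close>

lemma nonatomic_small_subset:
  assumes "nonatomic \<mu>" "A \<in> sets \<mu>" "0 < emeasure \<mu> A" "0 < e"
  shows "\<exists>B\<in>sets \<mu>. B \<subseteq> A \<and> 0 < emeasure \<mu> B \<and> emeasure \<mu> B \<le> ennreal e"
proof -
  \<comment> \<open>The strict inequality makes the measure of \<open>B\<close> finite even when
    that of \<open>A\<close> is infinite, so that halving can start.\<close>
  obtain B where B: "B \<in> sets \<mu>" "B \<subseteq> A" "0 < emeasure \<mu> B" "emeasure \<mu> B < emeasure \<mu> A"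
    using assms(1-3) unfolding nonatomic_def by blast
  then obtain a where a: "0 \<le> a" "emeasure \<mu> B = ennreal a"
    by (cases "emeasure \<mu> B") auto
  have "\<exists>D\<in>sets \<mu>. D \<subseteq> A \<and> 0 < emeasure \<mu> D \<and> emeasure \<mu> D \<le> ennreal (a / 2 ^ n)" for n
  proof (induction n)
    case 0
    show ?case using B a by auto
  next
    case (Suc n)
    then obtain D where D: "D \<in> sets \<mu>" "D \<subseteq> A" "0 < emeasure \<mu> D" "emeasure \<mu> D \<le> ennreal (a / 2 ^ n)"
      by blast
    obtain C where "C \<in> sets \<mu>" "C \<subseteq> D" "0 < emeasure \<mu> C" "emeasure \<mu> C \<le> ennreal (a / 2 ^ n / 2)"
      using nonatomic_halve[OF assms(1) D(1,3,4)] by blast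
    moreover have "a / 2 ^ n / 2 = a / 2 ^ Suc n" by simp
    ultimately show ?case using D(2) by (metis order_trans)
  qed
  moreover obtain n where "a / e < 2 ^ n"
    using real_arch_pow[of 2] by auto
  then have "a / 2 ^ n \<le> e"
    using assms(4) by (simp add: field_simps)
  ultimately show ?thesis by (meson ennreal_leI order_trans)
qed

text \<open>Sierpinski's theorem, by greedy exhaustion: each step adds a set of at least half the
  largest admissible measure.\<close>

lemma nonatomic_subset_emeasure:
  assumes "nonatomic \<mu>" and [measurable]: "A \<in> sets \<mu>" and "0 \<le> t" "ennreal t \<le> emeasure \<mu> A"
  shows "\<exists>E\<in>sets \<mu>. E \<subseteq> A \<and> emeasure \<mu> E = ennreal t"
proof -
  define P where "P E \<longleftrightarrow> E \<in> sets \<mu> \<and> E \<subseteq> A \<and> emeasure \<mu> E \<le> ennreal t" for E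
  define adm where "adm E = {D\<in>sets \<mu>. D \<subseteq> A - E \<and> emeasure \<mu> (E \<union> D) \<le> ennreal t}" for E
  \<comment> \<open>The greedy condition: no set that could have been added has more than twice the
    measure of what was added.\<close>
  define Q where "Q E E' \<longleftrightarrow> E \<subseteq> E' \<and> (\<forall>D\<in>adm E. emeasure \<mu> D \<le> 2 * emeasure \<mu> (E' - E))" for E E'
  have step: "\<exists>E'. P E' \<and> Q E E'" if "P E" for E
  proof -
    define s where "s = (SUP D\<in>adm E. emeasure \<mu> D)"
    have "s \<le> ennreal t"
      unfolding s_def
    proof (rule SUP_least)
      fix D assume "D \<in> adm E"
      with that have "E \<in> sets \<mu>" "D \<in> sets \<mu>" "emeasure \<mu> (E \<union> D) \<le> ennreal t"
        by (auto simp: P_def adm_def)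
      then show "emeasure \<mu> D \<le> ennreal t"
        using emeasure_mono[of D "E \<union> D" \<mu>] by auto
    qed
    then obtain r where r: "0 \<le> r" "s = ennreal r" by (cases s) (auto simp: top_unique)
    show ?thesis
    \<comment> \<open>If \<open>r = 0\<close>, every admissible set is null and \<open>E\<close> can
      stay. Otherwise \<open>r / 2\<close> is strictly below the supremum and some admissible set
      exceeds it.\<close>
    proof (cases "r = 0")
      case True
      have "emeasure \<mu> D \<le> s" if "D \<in> adm E" for D
        unfolding s_def using that by (rule SUP_upper)
      with that True r have "P E \<and> Q E E" by (auto simp: Q_def)
      then show ?thesis by blast
    next
      case False
      with r have "ennreal (r / 2) < s" by (simp add: ennreal_less_iff)
      then obtain D where D: "D \<in> adm E" "ennreal (r / 2) < emeasure \<mu> D"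
        unfolding s_def less_SUP_iff by blast
      have "E \<union> D - E = D" using D by (auto simp: adm_def)
      moreover have "emeasure \<mu> D' \<le> 2 * emeasure \<mu> D" if "D' \<in> adm E" for D'
      proof -
        have "emeasure \<mu> D' \<le> ennreal r" unfolding r(2)[symmetric] s_def using that by (rule SUP_upper)
        also have "\<dots> = 2 * ennreal (r / 2)" using r ennreal_mult[of 2 "r / 2"] by simp
        also have "\<dots> \<le> 2 * emeasure \<mu> D" using D(2) by (intro mult_left_mono) auto
        finally show ?thesis .
      qed
      ultimately have "P (E \<union> D) \<and> Q E (E \<union> D)"
        using that D(1) by (auto simp: P_def Q_def adm_def)
      then show ?thesis by blast
    qed
  qed
  have "P {}" by (simp add: P_def)
  then obtain E where E: "\<And>n. P (E n)" "\<And>n. Q (E n) (E (Suc n))"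
    using dependent_nat_choice[of "\<lambda>_. P" "\<lambda>_. Q"] step by blast
  have [measurable]: "E n \<in> sets \<mu>" for n using E(1) by (simp add: P_def)
  have inc: "incseq E" using E(2) by (auto intro: incseq_SucI simp: Q_def)
  define F where "F = (\<Union>n. E n)"
  have [measurable]: "F \<in> sets \<mu>" by (simp add: F_def)
  have FA: "F \<subseteq> A" using E(1) by (auto simp: F_def P_def)
  have "emeasure \<mu> F = (SUP n. emeasure \<mu> (E n))"
    unfolding F_def using inc by (subst SUP_emeasure_incseq) auto
  also have "\<dots> \<le> ennreal t" using E(1) by (intro SUP_least) (simp add: P_def)
  finally have Ft: "emeasure \<mu> F \<le> ennreal t" .
  have "emeasure \<mu> F = ennreal t"
  proof (rule ccontr)
    assume "emeasure \<mu> F \<noteq> ennreal t"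
    with Ft obtain c where c: "0 \<le> c" "emeasure \<mu> F = ennreal c" "c < t"
      using assms(3) by (cases "emeasure \<mu> F") (auto simp: top_unique)
    have "0 < emeasure \<mu> (A - F)"
    proof (rule ccontr)
      assume "\<not> ?thesis"
      then have "emeasure \<mu> A = emeasure \<mu> F"
        using plus_emeasure[of F \<mu> "A - F"] FA by (auto simp: Un_absorb1)
      with assms(4) c show False by simp
    qed
    \<comment> \<open>A piece of \<open>A - F\<close> that fits into the gap \<open>t - c\<close> is
      admissible at every step. Each increment then has at least half its measure, and the measures
      of the \<open>E n\<close> could not stay bounded by \<open>t\<close>.\<close>
    with nonatomic_small_subset[OF assms(1), of "A - F" "t - c"] c
    obtain B where [measurable]: "B \<in> sets \<mu>" and B: "B \<subseteq> A - F" "0 < emeasure \<mu> B"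
      "emeasure \<mu> B \<le> ennreal (t - c)" by auto
    obtain d where d: "0 < d" "emeasure \<mu> B = ennreal d"
      using B(2,3) by (cases "emeasure \<mu> B") (auto simp: top_unique)
    have admB: "B \<in> adm (E n)" for n
    proof -
      have "emeasure \<mu> (E n \<union> B) \<le> emeasure \<mu> (F \<union> B)"
        by (intro emeasure_mono) (auto simp: F_def)
      also have "\<dots> \<le> emeasure \<mu> F + emeasure \<mu> B"
        by (rule emeasure_subadditive) auto
      also have "\<dots> \<le> ennreal c + ennreal (t - c)"
        unfolding c(2) using B(3) by (rule add_left_mono)
      also have "\<dots> = ennreal t" using c by (simp flip: ennreal_plus)
      finally show ?thesis using B(1) by (auto simp: adm_def F_def)
    qed
    have gap: "ennreal d \<le> 2 * emeasure \<mu> (E (Suc n) - E n)" for n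
      unfolding d(2)[symmetric] using E(2)[of n] admB[of n] unfolding Q_def by blast
    have "ennreal (real n * d) \<le> 2 * emeasure \<mu> (E n)" for n
    proof (induction n)
      case (Suc n)
      have "ennreal (real (Suc n) * d) = ennreal (real n * d) + ennreal d"
        using d by (simp add: algebra_simps flip: ennreal_plus)
      also have "\<dots> \<le> 2 * emeasure \<mu> (E n) + 2 * emeasure \<mu> (E (Suc n) - E n)"
        by (intro add_mono Suc gap)
      also have "\<dots> = 2 * emeasure \<mu> (E n \<union> (E (Suc n) - E n))"
        by (subst plus_emeasure[symmetric]) (auto simp: distrib_left)
      also have "E n \<union> (E (Suc n) - E n) = E (Suc n)"
        using incseq_SucD[OF inc, of n] by auto
      finally show ?case .
    qed simp
    also have "2 * emeasure \<mu> (E n) \<le> 2 * ennreal t" for n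
      using E(1)[of n] by (intro mult_left_mono) (auto simp: P_def)
    finally have "ennreal (real n * d) \<le> ennreal (2 * t)" for n
      using assms(3) by (simp add: ennreal_mult)
    then have "real n * d \<le> 2 * t" for n
      using assms(3) d by (simp add: ennreal_le_iff)
    then show False
      using reals_Archimedean3[OF d(1)] by (metis not_less)
  qed
  with FA show ?thesis by (intro bexI[of _ F]) auto
qed

text \<open>Each of the two terms of \<open>cumul_rearr_le\<close> is at most \<open>S\<close>,
  whence the factor 2. The level set at the value \<open>rearr \<mu> f t\<close> has measure at most
  \<open>t\<close>, so it is itself a test set; the product term is tested on subsets of measure
  exactly \<open>t\<close> of lower levels, which exist by non-atomicity.\<close>

lemma cumul_rearr_le_if_set_le:
  assumes "sigma_finite_measure \<mu>" "nonatomic \<mu>" and [measurable]: "f \<in> mfun \<mu>" and t: "0 < t"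
    and S: "\<And>E. E \<in> sets \<mu> \<Longrightarrow> emeasure \<mu> E \<le> ennreal t \<Longrightarrow>
      (\<integral>\<^sup>+x. indicator E x * emod (f x) \<partial>\<mu>) \<le> S"
  shows "cumul (rearr \<mu> f) (ennreal t) \<le> 2 * S"
proof -
  have lev: "ennreal t * ennreal l \<le> S" if l: "0 \<le> l" "ennreal l < rearr \<mu> f t" for l
  proof -
    have "ennreal t \<le> emeasure \<mu> (upper_level \<mu> f l)"
      using less_rearr_iff[OF assms(3) l(1), of t] l(2) by simp
    then obtain E where E: "E \<in> sets \<mu>" "E \<subseteq> upper_level \<mu> f l" "emeasure \<mu> E = ennreal t"
      using nonatomic_subset_emeasure[OF assms(2), of "upper_level \<mu> f l" t] t by auto
    have "ennreal t * ennreal l = (\<integral>\<^sup>+x. ennreal l * indicator E x \<partial>\<mu>)"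
      using E by (simp add: nn_integral_cmult_indicator mult.commute)
    also have "\<dots> \<le> (\<integral>\<^sup>+x. indicator E x * emod (f x) \<partial>\<mu>)"
      using E(2) by (intro nn_integral_mono) (auto simp: upper_level_def split: split_indicator)
    also have "\<dots> \<le> S" using E by (intro S) auto
    finally show ?thesis .
  qed
  \<comment> \<open>Supremum of \<open>lev\<close> over \<open>l\<close>; the argument by
    contradiction also covers an infinite \<open>rearr \<mu> f t\<close>.\<close>
  have tS: "ennreal t * rearr \<mu> f t \<le> S"
  proof (rule ccontr)
    assume "\<not> ?thesis"
    then have less: "S < ennreal t * rearr \<mu> f t" by simp
    then obtain s where s: "0 \<le> s" "S = ennreal s" by (cases S) auto
    have "ennreal (s / t) < rearr \<mu> f t"
    proof (rule ccontr)
      assume "\<not> ?thesis"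
      then have "ennreal t * rearr \<mu> f t \<le> ennreal t * ennreal (s / t)"
        by (intro mult_left_mono) auto
      also have "\<dots> = S" using t s by (simp flip: ennreal_mult)
      finally show False using less by simp
    qed
    from dense[OF this] obtain l where l: "ennreal (s / t) < l" "l < rearr \<mu> f t" by blast
    then obtain l' where l': "0 \<le> l'" "l = ennreal l'" by (cases l) auto
    have "s / t < l'" using l(1) l' s t by (simp add: ennreal_less_iff)
    then have "s < t * l'" using t by (simp add: field_simps)
    moreover have "ennreal (t * l') \<le> ennreal s"
      using lev[OF l'(1)] l l' s t by (simp add: ennreal_mult)
    ultimately show False using s by (simp add: ennreal_le_iff)
  qed
  show ?thesis
  proof (cases "rearr \<mu> f t")
    case (real l)
    have "\<not> ennreal l < rearr \<mu> f t" by (simp add: real)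
    then have "emeasure \<mu> (upper_level \<mu> f l) \<le> ennreal t"
      using less_rearr_iff[OF assms(3) real(1)] by simp
    then have "(\<integral>\<^sup>+x. indicator (upper_level \<mu> f l) x * emod (f x) \<partial>\<mu>) \<le> S"
      by (intro S) auto
    with cumul_rearr_le[OF assms(1,3) real] tS real show ?thesis
      by (auto simp: mult_2 intro: order_trans add_mono)
  next
    case top
    with tS t have "S = \<infinity>" by (simp add: ennreal_mult_top top_unique)
    then show ?thesis by (simp add: ennreal_mult_top)
  qed
qed

text \<open>The test function is a multiple of the characteristic function of \<open>E\<close>,
  scaled so that its norm is at most 1.\<close>

lemma nn_integral_emod_set_le_associate_norm:
  assumes [measurable]: "f \<in> mfun \<mu>" "E \<in> sets \<mu>" "w \<in> borel_measurable half_line" and q: "0 < q"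
    and E: "emeasure \<mu> E \<le> ennreal t"
    and fin: "0 < cumul w (ennreal t)" "cumul w (ennreal t) < \<infinity>"
    and N: "\<And>g. N g = epowr (\<integral>\<^sup>+s. w s * epowr (rearr \<mu> g s) q \<partial>half_line) (1 / q)"
  shows "(\<integral>\<^sup>+x. indicator E x * emod (f x) \<partial>\<mu>) \<le>
    epowr (cumul w (ennreal t)) (1 / q) * associate_norm \<mu> N f"
proof -
  obtain W where W: "0 < W" "cumul w (ennreal t) = ennreal W"
    using fin by (cases "cumul w (ennreal t)") auto
  \<comment> \<open>With this value \<open>c powr q * W = 1\<close>.\<close>
  define c where "c = W powr (- 1 / q)"
  have c: "0 < c" using W by (simp add: c_def)
  define g where "g x = Fin (of_real (c * indicator E x))" for x
  have [measurable]: "g \<in> mfun \<mu>" unfolding g_def by measurable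
  have emod_g: "emod (g x) = ennreal c * indicator E x" for x
    using c by (auto simp: g_def split: split_indicator)
  \<comment> \<open>Only an upper bound holds, since \<open>E\<close> may have measure less than
    \<open>t\<close>. From \<open>t\<close> on, the rearrangement vanishes.\<close>
  have rg: "rearr \<mu> g s \<le> ennreal c * indicator (below (ennreal t)) s" if "0 < s" for s
  proof (cases "s < t")
    case True
    have "\<not> ennreal c < rearr \<mu> g s"
    proof -
      have "upper_level \<mu> g c = {}" by (auto simp: upper_level_def emod_g split: split_indicator)
      then show ?thesis using c by (subst less_rearr_iff) auto
    qed
    then show ?thesis using True that by (auto simp: below_ennreal)
  next
    case False
    have "emeasure \<mu> (upper_level \<mu> g 0) \<le> emeasure \<mu> E"
      by (intro emeasure_mono) (auto simp: upper_level_def emod_g split: split_indicator_asm)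
    also note E
    also have "ennreal t \<le> ennreal s" using False by (simp add: ennreal_leI)
    finally have "\<not> ennreal 0 < rearr \<mu> g s" by (subst less_rearr_iff) auto
    then show ?thesis by (simp add: zero_less_iff_neq_zero)
  qed
  have "(\<integral>\<^sup>+s. w s * epowr (rearr \<mu> g s) q \<partial>half_line) \<le>
      (\<integral>\<^sup>+s. ennreal (c powr q) * (w s * indicator (below (ennreal t)) s) \<partial>half_line)"
  proof (rule nn_integral_mono)
    fix s assume "s \<in> space half_line"
    then have "0 < s" by simp
    from epowr_mono[OF q rg[OF this]] have "epowr (rearr \<mu> g s) q \<le>
        ennreal (c powr q) * indicator (below (ennreal t)) s"
      using c by (auto simp: epowr_ennreal split: split_indicator)
    then show "w s * epowr (rearr \<mu> g s) q \<le>
        ennreal (c powr q) * (w s * indicator (below (ennreal t)) s)"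
      using mult_left_mono[of _ _ "w s"] by (fastforce simp: ac_simps)
  qed
  also have "\<dots> = ennreal (c powr q) * cumul w (ennreal t)"
    unfolding cumul_def
    by (rule nn_integral_cmult, intro borel_measurable_times_ennreal, fact,
        rule measurable_half_line, simp)
  also have "\<dots> = ennreal (c powr q * W)"
    using W by (simp add: ennreal_mult)
  also have "c powr q = W powr (- 1)"
    unfolding c_def powr_powr using q by simp
  also have "ennreal (W powr (- 1) * W) = 1"
    using W by (simp add: powr_minus)
  finally have "N g \<le> epowr 1 (1 / q)"
    unfolding N using q by (intro epowr_mono) auto
  then have "N g \<le> 1" using epowr_ennreal[of 1] by simp
  then have "(\<integral>\<^sup>+x. emod (f x) * emod (g x) \<partial>\<mu>) \<le> associate_norm \<mu> N f"
    unfolding associate_norm_def by (intro SUP_upper) simp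
  moreover have "(\<integral>\<^sup>+x. emod (f x) * emod (g x) \<partial>\<mu>) =
      ennreal c * (\<integral>\<^sup>+x. indicator E x * emod (f x) \<partial>\<mu>)"
    by (subst nn_integral_cmult[symmetric]) (auto simp: emod_g ac_simps)
  ultimately have "ennreal (W powr (1 / q)) * (ennreal c * (\<integral>\<^sup>+x. indicator E x * emod (f x) \<partial>\<mu>)) \<le>
      ennreal (W powr (1 / q)) * associate_norm \<mu> N f"
    by (intro mult_left_mono) auto
  moreover have "ennreal (W powr (1 / q)) * ennreal c = 1"
    using W by (simp add: c_def powr_minus flip: ennreal_mult)
  ultimately show ?thesis
    using W by (simp add: epowr_ennreal flip: mult.assoc)
qed

subsection \<open>Slowly varying weights\<close>

lemma equal_up_to_equivalenceI:
  assumes "0 < a" "0 < b"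
    and 1: "\<And>f. f \<in> mfun \<mu> \<Longrightarrow> N1 f \<le> ennreal a * N2 f"
    and 2: "\<And>f. f \<in> mfun \<mu> \<Longrightarrow> N2 f \<le> ennreal b * N1 f"
  shows "equal_up_to_equivalence \<mu> N1 N2"
proof -
  have "space_of \<mu> N1 = space_of \<mu> N2"
    using 1 2 by (fastforce simp: space_of_def ennreal_mult_less_top intro: le_less_trans)
  moreover have "N1 f \<le> ennreal (max a b) * N2 f" "N2 f \<le> ennreal (max a b) * N1 f"
    if "f \<in> mfun \<mu>" for f
    by (intro order_trans[OF 1[OF that]] mult_right_mono ennreal_leI, auto)
      (intro order_trans[OF 2[OF that]] mult_right_mono ennreal_leI, auto)
  ultimately show ?thesis
    unfolding equal_up_to_equivalence_def using assms(1) by (meson less_max_iff_disj)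
qed

lemma measurable_max_rearr [measurable]: "max_rearr \<mu> f \<in> borel_measurable half_line"
  unfolding max_rearr_eq[abs_def] by (intro measurable_half_line) measurable

text \<open>The assumptions on \<open>c\<close> and \<open>C\<close> make \<open>x t\<close>
  comparable to \<open>t * W t powr (- 1 / q)\<close>, so that
  \<open>x t * max_rearr \<mu> f t\<close> is comparable to \<open>W t powr (- 1 / q)\<close> times
  \<open>cumul (rearr \<mu> f) (ennreal t)\<close>. The two cases of the theorem are
  instances.\<close>

lemma associate_norm_weighted:
  fixes x W :: "real \<Rightarrow> real"
  assumes \<mu>: "sigma_finite_measure \<mu>" "nonatomic \<mu>"
    and q: "0 < q" "q \<le> 1"
    and [measurable]: "w \<in> borel_measurable half_line" "x \<in> borel_measurable half_line"
    and N: "\<And>g. N g = epowr (\<integral>\<^sup>+s. w s * epowr (rearr \<mu> g s) q \<partial>half_line) (1 / q)"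
    and W: "\<And>t. 0 < t \<Longrightarrow> cumul w (ennreal t) = ennreal (W t)" "\<And>t. 0 < t \<Longrightarrow> 0 < W t"
    and x: "\<And>t. 0 < t \<Longrightarrow> 0 < x t"
    and c: "0 < c" "\<And>t. 0 < t \<Longrightarrow> c * t \<le> x t * W t powr (1 / q)"
    and C: "0 < C" "\<And>t. 0 < t \<Longrightarrow> x t * W t powr (1 / q) \<le> C * t"
  shows "equal_up_to_equivalence \<mu> (associate_norm \<mu> N)
    (\<lambda>f. esssup half_line (\<lambda>t. ennreal (x t) * max_rearr \<mu> f t))"
proof (rule equal_up_to_equivalenceI)
  \<comment> \<open>In the first constant, \<open>1 / q\<close> comes from
    \<open>nn_integral_antimono_powr_le\<close>; in the second, 2 comes from
    \<open>cumul_rearr_le_if_set_le\<close>. The rest is the comparability of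
    \<open>x\<close>.\<close>
  show "0 < 1 / (c * q)" "0 < 2 * C" using q c C by auto
next
  fix f assume [measurable]: "f \<in> mfun \<mu>"
  let ?V = "esssup half_line (\<lambda>t. ennreal (x t) * max_rearr \<mu> f t)"
  \<comment> \<open>The shape \<open>K * epowr (cumul w m) (1 / q)\<close> demanded by
    \<open>nn_integral_emod_mult_le_weighted\<close>, with the target norm inside
    \<open>K\<close>.\<close>
  define G where "G m = ennreal (1 / c) * ?V * epowr (cumul w m) (1 / q)" for m
  have "mono G"
    unfolding G_def using q by (intro monoI mult_left_mono epowr_mono cumul_mono) auto
  moreover have "AE t in half_line. cumul (rearr \<mu> f) (ennreal t) \<le> G (ennreal t)"
  proof -
    have "AE t in half_line. ennreal (x t) * max_rearr \<mu> f t \<le> ?V" by (rule esssup_AE)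
    moreover have "AE t in half_line. 0 < t" by (rule AE_I2) simp
    ultimately show ?thesis
    proof eventually_elim
      case (elim t)
      have "cumul (rearr \<mu> f) (ennreal t) = ennreal (t / x t) * (ennreal (x t) * max_rearr \<mu> f t)"
        using elim(2) x[OF elim(2)] by (simp add: max_rearr_eq flip: mult.assoc ennreal_mult)
      also have "\<dots> \<le> ennreal (1 / c * W t powr (1 / q)) * ?V"
        using elim x[OF elim(2)] c(1) c(2)[OF elim(2)]
        by (intro mult_mono ennreal_leI) (auto simp: field_simps)
      also have "\<dots> = G (ennreal t)"
        using W(1)[OF elim(2)] W(2)[OF elim(2)] c(1)
        unfolding G_def by (subst ennreal_mult) (simp_all add: epowr_ennreal ac_simps)
      finally show ?case .
    qed
  qed
  ultimately have le: "cumul (rearr \<mu> f) m \<le> G m" for m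
    by (intro cumul_le_if_AE) auto
  show "associate_norm \<mu> N f \<le> ennreal (1 / (c * q)) * ?V"
    unfolding associate_norm_def
  proof (rule SUP_least, clarify)
    fix g assume [measurable]: "g \<in> mfun \<mu>" and g: "N g \<le> 1"
    have "(\<integral>\<^sup>+x. emod (f x) * emod (g x) \<partial>\<mu>) \<le> ennreal (1 / c) * ?V * (ennreal (1 / q) * N g)"
      unfolding N using le q by (intro nn_integral_emod_mult_le_weighted \<mu>) (auto simp: G_def)
    also have "\<dots> \<le> ennreal (1 / c) * ?V * (ennreal (1 / q) * 1)"
      by (intro mult_left_mono g) auto
    also have "\<dots> = ennreal (1 / c) * ennreal (1 / q) * ?V" by (simp add: ac_simps)
    also have "ennreal (1 / c) * ennreal (1 / q) = ennreal (1 / (c * q))"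
      using c(1) q(1) by (simp flip: ennreal_mult)
    finally show "(\<integral>\<^sup>+x. emod (f x) * emod (g x) \<partial>\<mu>) \<le> ennreal (1 / (c * q)) * ?V" .
  qed
  let ?A = "associate_norm \<mu> N f"
  show "?V \<le> ennreal (2 * C) * ?A"
  proof (rule esssup_I, measurable, rule AE_I2)
    fix t assume "t \<in> space half_line"
    then have t: "0 < t" by simp
    have "cumul (rearr \<mu> f) (ennreal t) \<le> 2 * (epowr (cumul w (ennreal t)) (1 / q) * ?A)"
      using W[OF t] q t
      by (intro cumul_rearr_le_if_set_le nn_integral_emod_set_le_associate_norm \<mu> N) auto
    then have "ennreal (x t / t) * cumul (rearr \<mu> f) (ennreal t) \<le>
        ennreal (x t / t) * (2 * (epowr (cumul w (ennreal t)) (1 / q) * ?A))"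
      by (rule mult_left_mono) simp
    moreover have "ennreal (x t) * max_rearr \<mu> f t = ennreal (x t / t) * cumul (rearr \<mu> f) (ennreal t)"
      using t x[OF t] by (simp add: max_rearr_eq flip: mult.assoc ennreal_mult)
    moreover have "ennreal (x t / t) * (2 * (epowr (cumul w (ennreal t)) (1 / q) * ?A)) =
        ennreal (2 * (x t * W t powr (1 / q) / t)) * ?A"
    proof -
      have "2 * (x t * W t powr (1 / q) / t) = x t / t * (2 * W t powr (1 / q))" by simp
      then show ?thesis
        using t x[OF t] W[OF t] by (simp add: epowr_ennreal ennreal_mult mult.assoc del: times_divide_eq_left)
    qed
    moreover have "\<dots> \<le> ennreal (2 * C) * ?A"
      using C(2)[OF t] t by (intro mult_right_mono ennreal_leI) (auto simp: field_simps)
    ultimately show "ennreal (x t) * max_rearr \<mu> f t \<le> ennreal (2 * C) * ?A" by simp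
  qed
qed

text \<open>Passing through the monotone equivalents costs the quotient of the two comparison
  constants; \<open>K\<close> is the larger of the two quotients. In this form the monotone
  functions themselves disappear.\<close>

lemma slowly_varying_almost_monotone:
  assumes "slowly_varying b" "0 < \<epsilon>"
  obtains K where "0 < K"
    "\<And>s t. 0 < s \<Longrightarrow> s \<le> t \<Longrightarrow> s powr \<epsilon> * b s \<le> K * (t powr \<epsilon> * b t)"
    "\<And>s t. 0 < s \<Longrightarrow> s \<le> t \<Longrightarrow> t powr (- \<epsilon>) * b t \<le> K * (s powr (- \<epsilon>) * b s)"
proof -
  obtain b1 b2 where b: "mono_on {0<..} b1" "antimono_on {0<..} b2"
    "approx_equiv (\<lambda>t. t powr \<epsilon> * b t) b1" "approx_equiv (\<lambda>t. t powr (- \<epsilon>) * b t) b2"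
    using assms unfolding slowly_varying_def by blast
  obtain c C d D where pos: "0 < c" "0 < C" "0 < d" "0 < D"
    and 1: "\<And>t. 0 < t \<Longrightarrow> c * b1 t \<le> t powr \<epsilon> * b t" "\<And>t. 0 < t \<Longrightarrow> t powr \<epsilon> * b t \<le> C * b1 t"
    and 2: "\<And>t. 0 < t \<Longrightarrow> d * b2 t \<le> t powr (- \<epsilon>) * b t" "\<And>t. 0 < t \<Longrightarrow> t powr (- \<epsilon>) * b t \<le> D * b2 t"
    using b(3,4) unfolding approx_equiv_def by metis
  have nonneg: "0 \<le> t powr e * b t" if "0 < t" for t e
    using assms(1) that by (simp add: slowly_varying_def less_imp_le)
  show ?thesis
  proof
    show "0 < max (C / c) (D / d)" using pos by (simp add: less_max_iff_disj)
  next
    fix s t :: real assume st: "0 < s" "s \<le> t"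
    then have t: "0 < t" by simp
    have "s powr \<epsilon> * b s \<le> C * b1 s" using 1 st by simp
    also have "\<dots> \<le> C * b1 t" using pos st t mono_onD[OF b(1)] by simp
    also have "\<dots> \<le> C / c * (t powr \<epsilon> * b t)" using 1(1)[OF t] pos by (simp add: field_simps)
    also have "\<dots> \<le> max (C / c) (D / d) * (t powr \<epsilon> * b t)"
      using nonneg[OF t] by (intro mult_right_mono) auto
    finally show "s powr \<epsilon> * b s \<le> max (C / c) (D / d) * (t powr \<epsilon> * b t)" .
    have "t powr (- \<epsilon>) * b t \<le> D * b2 t" using 2 t by simp
    also have "\<dots> \<le> D * b2 s" using pos st t monotone_onD[OF b(2), of s t] by simp
    also have "\<dots> \<le> D / d * (s powr (- \<epsilon>) * b s)" using 2(1)[OF st(1)] pos by (simp add: field_simps)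
    also have "\<dots> \<le> max (C / c) (D / d) * (s powr (- \<epsilon>) * b s)"
      using nonneg[OF st(1)] by (intro mult_right_mono) auto
    finally show "t powr (- \<epsilon>) * b t \<le> max (C / c) (D / d) * (s powr (- \<epsilon>) * b s)" .
  qed
qed

section \<open>Integrals of power weights and of the weight in \<open>LK_norm\<close>\<close>

lemma cumul_powr:
  assumes "0 < \<alpha>" "0 \<le> D" "0 \<le> t"
  shows "cumul (\<lambda>s. ennreal (D * s powr (\<alpha> - 1))) (ennreal t) = ennreal (D * (t powr \<alpha> / \<alpha>))"
proof -
  have "cumul (\<lambda>s. ennreal (D * s powr (\<alpha> - 1))) (ennreal t) =
      (\<integral>\<^sup>+s. ennreal D * (ennreal (s powr (\<alpha> - 1)) * indicator (below (ennreal t)) s) \<partial>lborel)"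
    unfolding cumul_def nn_integral_half_line using assms
    by (intro nn_integral_cong) (auto simp: below_def ennreal_mult split: split_indicator)
  also have "\<dots> = ennreal D * (ennreal (1 / \<alpha>) * epowr (ennreal t) \<alpha>)"
    using assms by (simp add: nn_integral_cmult nn_integral_below_powr)
  also have "\<dots> = ennreal (D * (t powr \<alpha> / \<alpha>))"
    using assms by (simp add: epowr_ennreal flip: ennreal_mult)
  finally show ?thesis .
qed

lemma cumul_mono_weight:
  assumes "\<And>s. 0 < s \<Longrightarrow> ennreal s < m \<Longrightarrow> w s \<le> w' s"
  shows "cumul w m \<le> cumul w' m"
  unfolding cumul_def using assms
  by (intro nn_integral_mono) (auto simp: below_def split: split_indicator)

text \<open>The parameter \<open>r\<close> stands for \<open>1 / p\<close>, so
  \<open>p = \<infinity>\<close> becomes \<open>r = 0\<close>.\<close>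

definition LK_weight :: "real \<Rightarrow> real \<Rightarrow> (real \<Rightarrow> real) \<Rightarrow> real \<Rightarrow> ennreal" where
  "LK_weight r q b t = ennreal ((t powr (r - 1 / q) * b t) powr q)"

lemma recip_ennreal: "0 < r \<Longrightarrow> recip (ennreal r) = 1 / r"
  by (simp add: recip_def inverse_ennreal inverse_eq_divide)

lemma recip_top [simp]: "recip top = 0"
  by (simp add: recip_def)

lemma LK_norm_eq:
  assumes "0 < q" "\<And>t. 0 < t \<Longrightarrow> 0 < b t"
  shows "LK_norm \<mu> p (ennreal q) b g =
    epowr (\<integral>\<^sup>+s. LK_weight (recip p) q b s * epowr (rearr \<mu> g s) q \<partial>half_line) (1 / q)"
proof -
  have "(\<integral>\<^sup>+t. epowr (ennreal (t powr (recip p - 1 / q) * b t) * rearr \<mu> g t) q \<partial>half_line) =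
      (\<integral>\<^sup>+s. LK_weight (recip p) q b s * epowr (rearr \<mu> g s) q \<partial>half_line)"
    using assms by (intro nn_integral_cong)
      (auto simp: LK_weight_def epowr_mult epowr_ennreal less_imp_le)
  then show ?thesis
    using assms(1) by (simp add: LK_norm_def Lq_norm_def recip_ennreal)
qed

lemma LK_max_norm_top:
  "LK_max_norm \<mu> p \<infinity> a f = esssup half_line (\<lambda>t. ennreal (t powr recip p * a t) * max_rearr \<mu> f t)"
  by (simp add: LK_max_norm_def Lq_norm_def)

lemma measurable_powr_half_line [measurable]: "(\<lambda>t. t powr r) \<in> borel_measurable half_line"
  by (intro measurable_half_line) measurable

lemma measurable_LK_weight [measurable]:
  assumes [measurable]: "b \<in> borel_measurable half_line"
  shows "LK_weight r q b \<in> borel_measurable half_line"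
  unfolding LK_weight_def[abs_def] by measurable

lemma recip_dual_exponent:
  assumes "1 \<le> P"
  shows "recip (dual_exponent (ennreal P)) = 1 - 1 / P"
proof (cases "P = 1")
  case False
  with assms have "1 < P" by simp
  then have "dual_exponent (ennreal P) = ennreal (P / (P - 1))"
    by (simp add: dual_exponent_def ennreal_minus divide_ennreal flip: ennreal_1)
  with \<open>1 < P\<close> show ?thesis by (simp add: recip_ennreal field_simps)
qed (simp add: dual_exponent_def)

lemma powr_mult_powr:
  assumes "0 < t" "0 < (c::real)"
  shows "(t powr e * c) powr q = t powr (q * e) * c powr q"
  using assms by (simp add: powr_mult powr_powr mult.commute)

text \<open>The weight is factored in two ways. The almost increasing
  \<open>s powr \<epsilon> * b s\<close> is replaced by its value at \<open>t\<close> for the upper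
  bound, the almost decreasing \<open>s powr (- \<epsilon>) * b s\<close> for the lower bound; what
  is left is a power weight.\<close>

lemma cumul_LK_weight_bounds:
  assumes b: "slowly_varying b" and r: "0 < r" and q: "0 < q"
  obtains A1 A2 where "0 < A1" "0 < A2"
    "\<And>t. 0 < t \<Longrightarrow> ennreal (A1 * (t powr r * b t) powr q) \<le> cumul (LK_weight r q b) (ennreal t)"
    "\<And>t. 0 < t \<Longrightarrow> cumul (LK_weight r q b) (ennreal t) \<le> ennreal (A2 * (t powr r * b t) powr q)"
proof -
  have bpos: "0 < b t" if "0 < t" for t using b that by (simp add: slowly_varying_def)
  \<comment> \<open>Half of \<open>r\<close>, so that the remaining exponents
    \<open>q * \<epsilon> - 1\<close> and \<open>q * (3 * \<epsilon>) - 1\<close> both exceed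
    \<open>- 1\<close> and are integrable at 0.\<close>
  define \<epsilon> where "\<epsilon> = r / 2"
  have \<epsilon>: "0 < \<epsilon>" "r = 2 * \<epsilon>" using r by (auto simp: \<epsilon>_def)
  obtain K where K: "0 < K"
    "\<And>s t. 0 < s \<Longrightarrow> s \<le> t \<Longrightarrow> s powr \<epsilon> * b s \<le> K * (t powr \<epsilon> * b t)"
    "\<And>s t. 0 < s \<Longrightarrow> s \<le> t \<Longrightarrow> t powr (- \<epsilon>) * b t \<le> K * (s powr (- \<epsilon>) * b s)"
    using slowly_varying_almost_monotone[OF b \<epsilon>(1)] by blast
  have w1: "LK_weight r q b s = ennreal ((s powr \<epsilon> * b s) powr q * s powr (q * \<epsilon> - 1))"
    and w2: "LK_weight r q b s = ennreal ((s powr (- \<epsilon>) * b s) powr q * s powr (q * (3 * \<epsilon>) - 1))"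
    if s: "0 < s" for s
  proof -
    have "q * (r - 1 / q) = q * \<epsilon> + (q * \<epsilon> - 1)" "q * (r - 1 / q) = q * - \<epsilon> + (q * (3 * \<epsilon>) - 1)"
      using q unfolding \<epsilon>(2) by (simp_all add: field_simps)
    then have "s powr (q * (r - 1 / q)) = s powr (q * \<epsilon>) * s powr (q * \<epsilon> - 1)"
      "s powr (q * (r - 1 / q)) = s powr (q * - \<epsilon>) * s powr (q * (3 * \<epsilon>) - 1)"
      by (metis powr_add)+
    then show "LK_weight r q b s = ennreal ((s powr \<epsilon> * b s) powr q * s powr (q * \<epsilon> - 1))"
      "LK_weight r q b s = ennreal ((s powr (- \<epsilon>) * b s) powr q * s powr (q * (3 * \<epsilon>) - 1))"
      unfolding LK_weight_def powr_mult_powr[OF s bpos[OF s]] by (simp_all only: ac_simps)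
  qed
  show ?thesis
  proof
    show "0 < (1 / K) powr q / (q * (3 * \<epsilon>))" "0 < K powr q / (q * \<epsilon>)"
      using K(1) q \<epsilon> by auto
  next
    fix t :: real assume t: "0 < t"
    have tr: "t powr (q * r) = t powr (q * \<epsilon>) * t powr (q * \<epsilon>)"
      "t powr (q * r) = t powr (q * - \<epsilon>) * t powr (q * (3 * \<epsilon>))"
      unfolding \<epsilon>(2) by (simp_all add: algebra_simps flip: powr_add)
    have "cumul (LK_weight r q b) (ennreal t) \<le>
        cumul (\<lambda>s. ennreal ((K * (t powr \<epsilon> * b t)) powr q * s powr (q * \<epsilon> - 1))) (ennreal t)"
    proof (rule cumul_mono_weight)
      fix s assume s: "0 < s" "ennreal s < ennreal t"
      then have "s \<le> t" by (simp add: ennreal_less_iff)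
      with K(2)[OF s(1)] s bpos[OF s(1)] q show "LK_weight r q b s \<le>
          ennreal ((K * (t powr \<epsilon> * b t)) powr q * s powr (q * \<epsilon> - 1))"
        unfolding w1[OF s(1)] by (intro ennreal_leI mult_right_mono powr_mono2) auto
    qed
    also have "\<dots> = ennreal ((K * (t powr \<epsilon> * b t)) powr q * (t powr (q * \<epsilon>) / (q * \<epsilon>)))"
      using q \<epsilon>(1) t by (intro cumul_powr) auto
    also have "(K * (t powr \<epsilon> * b t)) powr q * (t powr (q * \<epsilon>) / (q * \<epsilon>)) =
        K powr q / (q * \<epsilon>) * (t powr r * b t) powr q"
      unfolding powr_mult[of K] powr_mult_powr[OF t bpos[OF t]] tr(1) by simp
    finally show "cumul (LK_weight r q b) (ennreal t) \<le>
        ennreal (K powr q / (q * \<epsilon>) * (t powr r * b t) powr q)" .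
    have "(1 / K) powr q / (q * (3 * \<epsilon>)) * (t powr r * b t) powr q =
        (1 / K * (t powr (- \<epsilon>) * b t)) powr q * (t powr (q * (3 * \<epsilon>)) / (q * (3 * \<epsilon>)))"
      unfolding powr_mult[of "1 / K"] powr_mult_powr[OF t bpos[OF t]] tr(2) by simp
    also have "ennreal \<dots> =
        cumul (\<lambda>s. ennreal ((1 / K * (t powr (- \<epsilon>) * b t)) powr q * s powr (q * (3 * \<epsilon>) - 1))) (ennreal t)"
      using q \<epsilon>(1) t by (intro cumul_powr[symmetric]) auto
    also have "\<dots> \<le> cumul (LK_weight r q b) (ennreal t)"
    proof (rule cumul_mono_weight)
      fix s assume s: "0 < s" "ennreal s < ennreal t"
      then have "s \<le> t" by (simp add: ennreal_less_iff)
      from K(3)[OF s(1) this] have "1 / K * (t powr (- \<epsilon>) * b t) \<le> s powr (- \<epsilon>) * b s"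
        using K(1) by (simp add: field_simps)
      moreover have "0 \<le> 1 / K * (t powr (- \<epsilon>) * b t)"
        using K(1) bpos[OF t] by simp
      ultimately show "ennreal ((1 / K * (t powr (- \<epsilon>) * b t)) powr q * s powr (q * (3 * \<epsilon>) - 1)) \<le>
          LK_weight r q b s"
        unfolding w2[OF s(1)] using q by (intro ennreal_leI mult_right_mono powr_mono2) auto
    qed
    finally show "ennreal ((1 / K) powr q / (q * (3 * \<epsilon>)) * (t powr r * b t) powr q) \<le>
        cumul (LK_weight r q b) (ennreal t)" .
  qed
qed

text \<open>\<open>W t powr (1 / q)\<close> is comparable to \<open>t powr (1 / P) * b t\<close>,
  and the factor \<open>t powr (1 - 1 / P) / b t\<close> of the target norm multiplies this to
  \<open>t\<close>.\<close>

lemma associate_norm_LK_finite: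
  assumes \<mu>: "sigma_finite_measure \<mu>" "nonatomic \<mu>"
    and q: "0 < q" "q \<le> 1" and b: "slowly_varying b" and P: "1 \<le> P"
  shows "equal_up_to_equivalence \<mu> (associate_norm \<mu> (LK_norm \<mu> (ennreal P) (ennreal q) b))
    (LK_max_norm \<mu> (dual_exponent (ennreal P)) \<infinity> (\<lambda>t. 1 / b t))"
proof -
  have bpos: "0 < b t" if "0 < t" for t using b that by (simp add: slowly_varying_def)
  have [measurable]: "b \<in> borel_measurable half_line" using b by (simp add: slowly_varying_def)
  let ?w = "LK_weight (1 / P) q b" and ?\<phi> = "\<lambda>t. t powr (1 / P) * b t"
  obtain A1 A2 where A: "0 < A1" "0 < A2"
    "\<And>t. 0 < t \<Longrightarrow> ennreal (A1 * ?\<phi> t powr q) \<le> cumul ?w (ennreal t)"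
    "\<And>t. 0 < t \<Longrightarrow> cumul ?w (ennreal t) \<le> ennreal (A2 * ?\<phi> t powr q)"
    using cumul_LK_weight_bounds[OF b _ q(1), of "1 / P"] P by auto
  \<comment> \<open>The upper bound keeps \<open>cumul ?w (ennreal t)\<close> finite for positive
    \<open>t\<close>, so \<open>enn2real\<close> loses nothing there.\<close>
  define W where "W t = enn2real (cumul ?w (ennreal t))" for t
  have \<phi>: "0 < ?\<phi> t" if "0 < t" for t using bpos that by simp
  have W: "cumul ?w (ennreal t) = ennreal (W t)" if "0 < t" for t
    using le_less_trans[OF A(4)[OF that] ennreal_less_top] by (simp add: W_def)
  have W1: "A1 * ?\<phi> t powr q \<le> W t" and W2: "W t \<le> A2 * ?\<phi> t powr q" if "0 < t" for t
    using A(1,2) A(3,4)[OF that] unfolding W[OF that] by (simp_all add: W_def ennreal_le_iff)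
  have Wpos: "0 < W t" if "0 < t" for t
    using \<phi>[OF that] A(1) by (intro less_le_trans[OF _ W1[OF that]] mult_pos_pos)
      (simp_all only: powr_gt_zero)
  have root: "(a * ?\<phi> t powr q) powr (1 / q) = a powr (1 / q) * ?\<phi> t" if "0 < t" "0 < a" for t a
    using \<phi>[OF that(1)] that q by (simp add: powr_mult[of a] powr_powr)
  let ?x = "\<lambda>t. t powr (1 - 1 / P) * (1 / b t)"
  have x\<phi>: "?x t * (a * ?\<phi> t) = a * t" if "0 < t" for t a
    using bpos[OF that] that by (simp add: powr_diff field_simps)
  have "equal_up_to_equivalence \<mu> (associate_norm \<mu> (LK_norm \<mu> (ennreal P) (ennreal q) b))
      (\<lambda>f. esssup half_line (\<lambda>t. ennreal (?x t) * max_rearr \<mu> f t))"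
  proof (rule associate_norm_weighted[OF \<mu> q, where w = ?w and W = W
        and c = "A1 powr (1 / q)" and C = "A2 powr (1 / q)"])
    show "LK_norm \<mu> (ennreal P) (ennreal q) b g =
        epowr (\<integral>\<^sup>+s. ?w s * epowr (rearr \<mu> g s) q \<partial>half_line) (1 / q)" for g
      using LK_norm_eq[OF q(1) bpos, where p = "ennreal P"] P by (simp add: recip_ennreal)
    fix t :: real assume t: "0 < t"
    show "0 < ?x t" using t bpos by simp
    have "A1 powr (1 / q) * t = ?x t * (A1 * ?\<phi> t powr q) powr (1 / q)"
      unfolding root[OF t A(1)] x\<phi>[OF t] ..
    also have "\<dots> \<le> ?x t * W t powr (1 / q)"
      using W1[OF t] q A(1) bpos[OF t] by (intro mult_left_mono powr_mono2) auto
    finally show "A1 powr (1 / q) * t \<le> ?x t * W t powr (1 / q)" .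
    have "?x t * W t powr (1 / q) \<le> ?x t * (A2 * ?\<phi> t powr q) powr (1 / q)"
      using W2[OF t] Wpos[OF t] q bpos[OF t] by (intro mult_left_mono powr_mono2) auto
    also have "\<dots> = A2 powr (1 / q) * t"
      unfolding root[OF t A(2)] x\<phi>[OF t] ..
    finally show "?x t * W t powr (1 / q) \<le> A2 powr (1 / q) * t" .
  qed (use W Wpos A(1,2) in \<open>auto\<close>)
  then show ?thesis
    by (simp only: LK_max_norm_top[abs_def] recip_dual_exponent[OF P])
qed

lemma associate_norm_LK_top:
  assumes \<mu>: "sigma_finite_measure \<mu>" "nonatomic \<mu>"
    and q: "0 < q" "q \<le> 1" and b: "slowly_varying b"
    and fin: "Lq_norm (ennreal q) (\<lambda>t. ennreal (t powr (- 1 / q) * b t * indicator {0<..<1} t)) < \<infinity>"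
  shows "equal_up_to_equivalence \<mu> (associate_norm \<mu> (LK_norm \<mu> \<infinity> (ennreal q) b))
    (LK_max_norm \<mu> 1 \<infinity>
      (\<lambda>t. (LINT s:{0<..<t}|lebesgue. s powr (- 1) * b s powr q) powr (- 1 / q)))"
proof -
  have bpos: "0 < b t" if "0 < t" for t using b that by (simp add: slowly_varying_def)
  have [measurable]: "b \<in> borel_measurable half_line" using b by (simp add: slowly_varying_def)
  let ?w = "LK_weight 0 q b"
  have w: "?w s = ennreal (s powr (- 1) * b s powr q)" if "0 < s" for s
    using that bpos[OF that] q by (simp add: LK_weight_def powr_mult powr_powr less_imp_le)
  define W where "W t = (LINT s:{0<..<t}|lebesgue. s powr (- 1) * b s powr q)" for t
  \<comment> \<open>The Bochner integral in the statement agrees with \<open>cumul\<close>, also in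
    the divergent case, where both sides are 0.\<close>
  have WE: "W t = enn2real (cumul ?w (ennreal t))" for t
  proof -
    \<comment> \<open>\<open>b\<close> is measurable only on the half-line, so the integrand is
      first extended by 0.\<close>
    have "(\<lambda>s. indicator {0<..} s *\<^sub>R (s powr (- 1) * b s powr q)) \<in> borel_measurable lebesgue"
      by (subst borel_measurable_restrict_space_iff[symmetric], simp, measurable)
    then have "(\<lambda>s. indicator {0<..<t} s *\<^sub>R (indicator {0<..} s *\<^sub>R (s powr (- 1) * b s powr q)))
        \<in> borel_measurable lebesgue"
      by (rule borel_measurable_scaleR[rotated]) (intro borel_measurable_indicator, simp)
    also have "(\<lambda>s. indicator {0<..<t} s *\<^sub>R (indicator {0<..} s *\<^sub>R (s powr (- 1) * b s powr q))) =
        (\<lambda>s. indicator {0<..<t} s *\<^sub>R (s powr (- 1) * b s powr q))"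
      by (auto simp: fun_eq_iff split: split_indicator)
    finally have "W t = enn2real (\<integral>\<^sup>+s. ennreal (indicator {0<..<t} s *\<^sub>R (s powr (- 1) * b s powr q)) \<partial>lebesgue)"
      unfolding W_def set_lebesgue_integral_def by (intro integral_eq_nn_integral) auto
    also have "(\<integral>\<^sup>+s. ennreal (indicator {0<..<t} s *\<^sub>R (s powr (- 1) * b s powr q)) \<partial>lebesgue) =
        cumul ?w (ennreal t)"
      unfolding cumul_ennreal by (intro nn_integral_cong) (auto simp: w split: split_indicator)
    finally show ?thesis .
  qed
  obtain K where K: "0 < K"
    "\<And>s t. 0 < s \<Longrightarrow> s \<le> t \<Longrightarrow> s powr 1 * b s \<le> K * (t powr 1 * b t)"
    "\<And>s t. 0 < s \<Longrightarrow> s \<le> t \<Longrightarrow> t powr (- 1) * b t \<le> K * (s powr (- 1) * b s)"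
    using slowly_varying_almost_monotone[OF b zero_less_one] by metis
  have W: "cumul ?w (ennreal t) = ennreal (W t)" and Wpos: "0 < W t" if t: "0 < t" for t
  proof -
    have "(\<integral>\<^sup>+t. epowr (ennreal (t powr (- 1 / q) * b t * indicator {0<..<1} t)) q \<partial>half_line) =
        cumul ?w (ennreal 1)"
      unfolding cumul_def below_ennreal using q bpos
      by (intro nn_integral_cong)
        (auto simp: LK_weight_def epowr_ennreal less_imp_le split: split_indicator)
    \<comment> \<open>The hypothesis says that \<open>W\<close> is finite at 1.\<close>
    with fin q have fin1: "cumul ?w (ennreal 1) < \<infinity>"
      by (auto simp: Lq_norm_def epowr_def less_top split: if_splits)
    \<comment> \<open>Bounds the weight on \<open>[1, t)\<close>: there
      \<open>b s \<le> s * b s \<le> K * (t * b t)\<close> and \<open>s powr (- 1) \<le> 1\<close>.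
      The factor \<open>s powr (1 - 1)\<close> below puts this constant into the form required by
      \<open>cumul_powr\<close>.\<close>
    let ?k = "(K * (t * b t)) powr q"
    have le: "?w s \<le> ?w s * indicator (below (ennreal 1)) s + ennreal (?k * s powr (1 - 1))"
      if s: "0 < s" "ennreal s < ennreal t" for s
    proof (cases "s < 1")
      case False
      have "b s \<le> s * b s" using False bpos[OF s(1)] by simp
      also have "\<dots> \<le> K * (t * b t)" using K(2)[of s t] s t by (simp add: ennreal_less_iff)
      finally have "b s powr q \<le> ?k" using bpos[OF s(1)] q by (intro powr_mono2) auto
      moreover have "s powr (- 1) * b s powr q \<le> 1 * b s powr q"
        using False by (intro mult_right_mono) (auto simp: powr_minus_divide)
      ultimately show ?thesis
        using s by (intro add_increasing) (auto simp: w intro!: ennreal_leI)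
    qed (use s in \<open>simp add: below_def ennreal_less_one_iff\<close>)
    have "cumul ?w (ennreal t) \<le>
        cumul (\<lambda>s. ?w s * indicator (below (ennreal 1)) s + ennreal (?k * s powr (1 - 1))) (ennreal t)"
      by (rule cumul_mono_weight) (rule le)
    also have "\<dots> \<le> (\<integral>\<^sup>+s. ?w s * indicator (below (ennreal 1)) s +
        ennreal (?k * s powr (1 - 1)) * indicator (below (ennreal t)) s \<partial>half_line)"
      unfolding cumul_def by (intro nn_integral_mono) (auto split: split_indicator)
    also have "\<dots> = cumul ?w (ennreal 1) + cumul (\<lambda>s. ennreal (?k * s powr (1 - 1))) (ennreal t)"
      unfolding cumul_def
    proof (rule nn_integral_add)
      show "(\<lambda>s. ?w s * indicator (below (ennreal 1)) s) \<in> borel_measurable half_line"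
        by (rule borel_measurable_times_ennreal, measurable, rule measurable_half_line, simp)
      show "(\<lambda>s. ennreal (?k * s powr (1 - 1)) * indicator (below (ennreal t)) s) \<in> borel_measurable half_line"
        by (rule measurable_half_line) measurable
    qed
    also have "\<dots> < \<infinity>"
      using fin1 cumul_powr[of 1 ?k t] t by simp
    finally have fint: "cumul ?w (ennreal t) < \<infinity>" .
    then show "cumul ?w (ennreal t) = ennreal (W t)"
      unfolding WE by (intro ennreal_enn2real[symmetric]) simp
    \<comment> \<open>For positivity, \<open>s powr (- 1) * b s\<close> is almost decreasing, so on
      \<open>(0, t)\<close> the weight is at least \<open>?d * s powr (q - 1)\<close>, whose
      integral is positive.\<close>
    let ?d = "(1 / K * (t powr (- 1) * b t)) powr q"
    have "0 < ennreal (?d * (t powr q / q))"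
      using K(1) bpos[OF t] t q by simp
    also have "\<dots> = cumul (\<lambda>s. ennreal (?d * s powr (q - 1))) (ennreal t)"
      using q t by (intro cumul_powr[symmetric]) auto
    also have "\<dots> \<le> cumul ?w (ennreal t)"
    proof (rule cumul_mono_weight)
      fix s assume s: "0 < s" "ennreal s < ennreal t"
      have "1 / K * (t powr (- 1) * b t) \<le> s powr (- 1) * b s"
        using K(3)[of s t] K(1) s t by (simp add: ennreal_less_iff field_simps)
      moreover have "0 \<le> 1 / K * (t powr (- 1) * b t)"
        using K(1) bpos[OF t] by simp
      ultimately have "?d \<le> (s powr (- 1) * b s) powr q"
        using q by (intro powr_mono2) auto
      then have "?d * s powr (q - 1) \<le> (s powr (- 1) * b s) powr q * s powr (q - 1)"
        by (intro mult_right_mono) auto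
      also have "\<dots> = s powr (- 1) * b s powr q"
      proof -
        have "s powr (- 1) = s powr (q * (- 1)) * s powr (q - 1)"
          unfolding powr_add[symmetric] by simp
        then show ?thesis
          unfolding powr_mult_powr[OF s(1) bpos[OF s(1)]] by (simp only: ac_simps)
      qed
      finally show "ennreal (?d * s powr (q - 1)) \<le> ?w s"
        unfolding w[OF s(1)] by (rule ennreal_leI)
    qed
    finally show "0 < W t"
      unfolding WE using fint by (simp add: enn2real_positive_iff)
  qed
  let ?x = "\<lambda>t. t powr 1 * W t powr (- 1 / q)"
  have x: "?x t * W t powr (1 / q) = 1 * t" if "0 < t" for t
    using Wpos[OF that] that by (simp flip: powr_add)
  have "equal_up_to_equivalence \<mu> (associate_norm \<mu> (LK_norm \<mu> \<infinity> (ennreal q) b))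
      (\<lambda>f. esssup half_line (\<lambda>t. ennreal (?x t) * max_rearr \<mu> f t))"
  proof (rule associate_norm_weighted[OF \<mu> q, where w = ?w and W = W and c = 1 and C = 1])
    show "LK_norm \<mu> \<infinity> (ennreal q) b g =
        epowr (\<integral>\<^sup>+s. ?w s * epowr (rearr \<mu> g s) q \<partial>half_line) (1 / q)" for g
      using LK_norm_eq[OF q(1) bpos, where p = \<infinity>] by simp
    show "?x \<in> borel_measurable half_line"
      unfolding WE by (intro measurable_half_line) measurable
    fix t :: real assume t: "0 < t"
    show "0 < ?x t" using t Wpos[OF t] by simp
    show "1 * t \<le> ?x t * W t powr (1 / q)" "?x t * W t powr (1 / q) \<le> 1 * t"
      using x[OF t] by auto
  qed (use W Wpos in auto)
  moreover have "recip 1 = 1" by (simp add: recip_def)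
  ultimately show ?thesis
    by (simp only: LK_max_norm_top[abs_def] W_def)
qed

theorem theorem3p30:
  fixes \<mu> :: "'a measure" and p :: ennreal and q :: real and b :: "real \<Rightarrow> real"
  assumes "sigma_finite_measure \<mu>" and "nonatomic \<mu>" and "emeasure \<mu> (space \<mu>) = \<infinity>"
    and "0 < p" and "0 < q" and "q \<le> 1" and "slowly_varying b"
  shows "(1 \<le> p \<and> p < \<infinity> \<longrightarrow>
           equal_up_to_equivalence \<mu>
             (associate_norm \<mu> (LK_norm \<mu> p (ennreal q) b))
             (LK_max_norm \<mu> (dual_exponent p) \<infinity> (\<lambda>t. 1 / b t)))
       \<and> (p = \<infinity> \<and>
           Lq_norm (ennreal q) (\<lambda>t. ennreal (t powr (- 1 / q) * b t * indicator {0<..<1} t)) < \<infinity> \<longrightarrow>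
           equal_up_to_equivalence \<mu>
             (associate_norm \<mu> (LK_norm \<mu> \<infinity> (ennreal q) b))
             (LK_max_norm \<mu> 1 \<infinity>
               (\<lambda>t. (LINT s:{0<..<t}|lebesgue. s powr (- 1) * b s powr q) powr (- 1 / q))))"
proof (intro conjI impI; elim conjE)
  assume p: "1 \<le> p" "p < \<infinity>"
  then obtain P where P: "p = ennreal P" "0 \<le> P" by (cases p) auto
  with p(1) have "1 \<le> P" by simp
  with assms show "equal_up_to_equivalence \<mu> (associate_norm \<mu> (LK_norm \<mu> p (ennreal q) b))
      (LK_max_norm \<mu> (dual_exponent p) \<infinity> (\<lambda>t. 1 / b t))"
    unfolding P by (intro associate_norm_LK_finite)
next
  assume "Lq_norm (ennreal q) (\<lambda>t. ennreal (t powr (- 1 / q) * b t * indicator {0<..<1} t)) < \<infinity>"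
  with assms show "equal_up_to_equivalence \<mu> (associate_norm \<mu> (LK_norm \<mu> \<infinity> (ennreal q) b))
      (LK_max_norm \<mu> 1 \<infinity>
        (\<lambda>t. (LINT s:{0<..<t}|lebesgue. s powr (- 1) * b s powr q) powr (- 1 / q)))"
    by (intro associate_norm_LK_top)
qed

end
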